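(* Let $(A\to X,\rho,[\cdot,\cdot])$ be a holomorphic Lie algebroid, let $A_R$ be its underlying real Lie algebroid, and let $j:A_R\to A_R$ be the real bundle endomorphism given by multiplication by $\sqrt{-1}$ in the fibers of $A$. Then the Nijenhuis torsion of $j$ vanishes, i.e. $$[jV,jW]-j\big([jV,W]+[V,jW]-j[V,W]\big)=0$$ for all smooth sections $V,W$ of $A_R$.
   Context: A holomorphic Lie algebroid over a complex manifold $X$ is a holomorphic vector bundle $A\to X$ with a holomorphic bundle map $\rho:A\to TX$ and a structure of sheaf of complex Lie algebras on its sheaf $\mathcal A$ of holomorphic sections such that (1) $\rho$ induces a homomorphism of sheaves of complex Lie algebras from $\mathcal A$ to the sheaf of holomorphic vector fields; (2) $[V,fW]=(\rho(V)f)W+f[V,W]$ for holomorphic sections $V,W$ and holomorphic functions $f$ on open subsets. The underlying real Lie algebroid $A_R$ is the unique real smooth Lie algebroid structure on the underlying real vector bundle of $A$, with the same anchor $\rho$, whose bracket on smooth sections extends the bracket on holomorphic sections. *)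

theory Defs
  imports "HOL-Analysis.Analysis"
begin

section \<open>Finite-dimensional complex vector spaces\<close>

text \<open>
  These are the model spaces of complex manifolds and of the fibers of vector bundles.
  Dimension \<open>0\<close> is allowed (which is why \<open>euclidean_space\<close> or \<open>complex ^ 'n\<close> is not used).
  The inner product only provides the topology and the differential calculus,
  which do not depend on its choice in finite dimension; it need not be Hermitian.
\<close>

class complex_euclidean_space = real_inner +
  fixes scaleC :: "complex \<Rightarrow> 'a \<Rightarrow> 'a"  (infixr "*\<^sub>C" 75)
  assumes scaleC_add_right: "a *\<^sub>C (x + y) = a *\<^sub>C x + a *\<^sub>C y"
    and scaleC_add_left: "(a + b) *\<^sub>C x = a *\<^sub>C x + b *\<^sub>C x"
    and scaleC_scaleC: "a *\<^sub>C b *\<^sub>C x = (a * b) *\<^sub>C x"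
    and scaleC_of_real: "complex_of_real r *\<^sub>C x = r *\<^sub>R x"
    \<comment> \<open>finite dimension: finitely many linear forms separate the points\<close>
    and finite_dimensional: "\<exists>B. finite B \<and> (\<forall>x. (\<forall>b\<in>B. inner x b = 0) \<longrightarrow> x = 0)"

instantiation complex :: complex_euclidean_space
begin

definition scaleC_complex :: "complex \<Rightarrow> complex \<Rightarrow> complex"
  where "scaleC_complex a x = a * x"

instance
proof
  show "\<exists>B::complex set. finite B \<and> (\<forall>x. (\<forall>b\<in>B. inner x b = 0) \<longrightarrow> x = 0)"
    using euclidean_all_zero_iff by (intro exI[of _ Basis]) auto
qed (simp_all add: scaleC_complex_def algebra_simps scaleR_conv_of_real)

end

instantiation prod :: (complex_euclidean_space, complex_euclidean_space) complex_euclidean_space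
begin

definition scaleC_prod :: "complex \<Rightarrow> 'a \<times> 'b \<Rightarrow> 'a \<times> 'b"
  where "scaleC_prod a x = (a *\<^sub>C fst x, a *\<^sub>C snd x)"

instance
proof
  obtain B :: "'a set" where B: "finite B" "\<And>x. (\<forall>b\<in>B. inner x b = 0) \<Longrightarrow> x = 0"
    using finite_dimensional by blast
  obtain D :: "'b set" where D: "finite D" "\<And>x. (\<forall>b\<in>D. inner x b = 0) \<Longrightarrow> x = 0"
    using finite_dimensional by blast
  let ?B = "(\<lambda>b. (b, 0)) ` B \<union> (\<lambda>d. (0, d)) ` D"
  have "x = 0" if "\<forall>b\<in>?B. inner x b = 0" for x :: "'a \<times> 'b"
  proof (rule prod_eqI)
    have "inner (fst x) b = 0" if "b \<in> B" for b
      using \<open>\<forall>b\<in>?B. inner x b = 0\<close>[rule_format, of "(b, 0)"] that by (simp add: inner_prod_def)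
    then show "fst x = fst 0" using B(2) by simp
    have "inner (snd x) b = 0" if "b \<in> D" for b
      using \<open>\<forall>b\<in>?B. inner x b = 0\<close>[rule_format, of "(0, b)"] that by (simp add: inner_prod_def)
    then show "snd x = snd 0" using D(2) by simp
  qed
  then show "\<exists>B::('a \<times> 'b) set. finite B \<and> (\<forall>x. (\<forall>b\<in>B. inner x b = 0) \<longrightarrow> x = 0)"
    using B(1) D(1) by (intro exI[of _ ?B]) simp
qed (simp_all add: scaleC_prod_def scaleC_add_right scaleC_add_left scaleC_scaleC scaleC_of_real
      prod_eq_iff)

end

instantiation vec :: (complex_euclidean_space, finite) complex_euclidean_space
begin

definition scaleC_vec :: "complex \<Rightarrow> 'a ^ 'b \<Rightarrow> 'a ^ 'b"
  where "scaleC_vec a x = (\<chi> i. a *\<^sub>C (x $ i))"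

instance
proof
  obtain B :: "'a set" where B: "finite B" "\<And>x. (\<forall>b\<in>B. inner x b = 0) \<Longrightarrow> x = 0"
    using finite_dimensional by blast
  let ?B = "(\<Union>i. axis i ` B) :: ('a ^ 'b) set"
  have "x = 0" if "\<forall>b\<in>?B. inner x b = 0" for x :: "'a ^ 'b"
    using that by (auto intro!: B(2) simp: vec_eq_iff inner_axis)
  then show "\<exists>B::('a ^ 'b) set. finite B \<and> (\<forall>x. (\<forall>b\<in>B. inner x b = 0) \<longrightarrow> x = 0)"
    using B(1) by (intro exI[of _ ?B]) simp
qed (simp_all add: scaleC_vec_def scaleC_add_right scaleC_add_left scaleC_scaleC scaleC_of_real
      vec_eq_iff)

end

section \<open>Smooth and holomorphic maps between model spaces\<close>

text \<open>
  Both notions are only used on open sets \<open>S\<close>.  In finite dimension, continuity of all iterated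
  directional derivatives of a Frechet differentiable map is the usual \<open>C\<^sup>k\<close> condition.
\<close>

primrec Ck_on :: "nat \<Rightarrow> 'm::real_normed_vector set \<Rightarrow> ('m \<Rightarrow> 'k::real_normed_vector) \<Rightarrow> bool"
  where
    "Ck_on 0 S f \<longleftrightarrow> continuous_on S f"
  | "Ck_on (Suc k) S f \<longleftrightarrow> (\<forall>p\<in>S. f differentiable (at p)) \<and>
       (\<forall>v. Ck_on k S (\<lambda>p. frechet_derivative f (at p) v))"

definition smooth_on :: "'m::real_normed_vector set \<Rightarrow> ('m \<Rightarrow> 'k::real_normed_vector) \<Rightarrow> bool"
  where "smooth_on S f \<longleftrightarrow> (\<forall>k. Ck_on k S f)"

text \<open>
  Holomorphic maps of several complex variables: smooth maps whose differential is complex linear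
  (the Cauchy--Riemann equations).
\<close>

definition holo_on ::
    "'m::complex_euclidean_space set \<Rightarrow> ('m \<Rightarrow> 'k::complex_euclidean_space) \<Rightarrow> bool"
  where "holo_on S f \<longleftrightarrow> smooth_on S f \<and>
    (\<forall>p\<in>S. \<forall>c v. frechet_derivative f (at p) (c *\<^sub>C v) = c *\<^sub>C frechet_derivative f (at p) v)"

section \<open>Complex manifolds\<close>

text \<open>
  A chart \<open>(U, \<phi>)\<close> is a map \<open>\<phi>\<close> of which only the values on the set \<open>U\<close> matter.  A manifold is
  given by its atlas; its set of points is the union of the chart domains, and its topology is the
  one for which the charts are homeomorphisms from open sets onto open sets of the model space.
\<close>

type_synonym ('a, 'm) chart = "'a set \<times> ('a \<Rightarrow> 'm)"

definition points :: "('a, 'm) chart set \<Rightarrow> 'a set"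
  where "points C = \<Union> (fst ` C)"

definition mtop :: "('a, 'm::topological_space) chart set \<Rightarrow> 'a topology"
  where "mtop C =
    topology (\<lambda>W. W \<subseteq> points C \<and> (\<forall>(U, \<phi>)\<in>C. open (\<phi> ` (U \<inter> W))))"

definition complex_manifold :: "('a, 'm::complex_euclidean_space) chart set \<Rightarrow> bool"
  where "complex_manifold C \<longleftrightarrow>
    (\<forall>(U, \<phi>)\<in>C. inj_on \<phi> U \<and> open (\<phi> ` U)) \<and>
    (\<forall>(U, \<phi>)\<in>C. \<forall>(V, \<psi>)\<in>C. open (\<phi> ` (U \<inter> V)) \<and>
       holo_on (\<phi> ` (U \<inter> V)) (\<psi> \<circ> inv_into U \<phi>)) \<and>
    Hausdorff_space (mtop C) \<and> second_countable (mtop C)"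

text \<open>The collection in the definition of \<^const>\<open>mtop\<close> is a topology:\<close>

lemma openin_mtop:
  fixes C :: "('a, 'm::complex_euclidean_space) chart set"
  assumes "complex_manifold C"
  shows "openin (mtop C) W \<longleftrightarrow> W \<subseteq> points C \<and> (\<forall>(U, \<phi>)\<in>C. open (\<phi> ` (U \<inter> W)))"
proof -
  have inj: "inj_on \<phi> U" if "(U, \<phi>) \<in> C" for U \<phi>
    using assms that unfolding complex_manifold_def by blast
  let ?O = "\<lambda>W. W \<subseteq> points C \<and> (\<forall>(U, \<phi>)\<in>C. open (\<phi> ` (U \<inter> W)))"
  have "?O (S \<inter> T)" if "?O S" "?O T" for S T
  proof -
    have "open (\<phi> ` (U \<inter> (S \<inter> T)))" if c: "(U, \<phi>) \<in> C" for U \<phi>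
    proof -
      have "\<phi> ` (U \<inter> (S \<inter> T)) = \<phi> ` (U \<inter> S) \<inter> \<phi> ` (U \<inter> T)"
        using inj[OF c] by (auto simp: inj_on_def)
      then show ?thesis using \<open>?O S\<close> \<open>?O T\<close> c by auto
    qed
    then show ?thesis using that by auto
  qed
  moreover have "?O (\<Union> \<K>)" if K: "\<forall>K\<in>\<K>. ?O K" for \<K>
  proof -
    have "open (\<phi> ` (U \<inter> \<Union> \<K>))" if "(U, \<phi>) \<in> C" for U \<phi>
    proof -
      have "\<phi> ` (U \<inter> \<Union> \<K>) = (\<Union>K\<in>\<K>. \<phi> ` (U \<inter> K))" by blast
      moreover have "open (\<Union>K\<in>\<K>. \<phi> ` (U \<inter> K))"
        using K that by (intro open_UN) auto
      ultimately show ?thesis by simp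
    qed
    moreover have "\<Union> \<K> \<subseteq> points C" using K by blast
    ultimately show ?thesis by auto
  qed
  ultimately have "istopology ?O"
    unfolding istopology_def by blast
  then show ?thesis
    unfolding mtop_def by (simp add: topology_inverse')
qed

text \<open>
  \<open>mfd_map P C D W f\<close>: the map \<open>f\<close>, defined on the open set \<open>W\<close> of the manifold \<open>C\<close>, with values
  in the manifold \<open>D\<close>, is of class \<open>P\<close>, where \<open>P\<close> is \<^const>\<open>smooth_on\<close> or \<^const>\<open>holo_on\<close>.
  The openness condition expresses continuity.
\<close>

definition mfd_map ::
    "('m::topological_space set \<Rightarrow> ('m \<Rightarrow> 'k) \<Rightarrow> bool) \<Rightarrow>
     ('a, 'm) chart set \<Rightarrow> ('b, 'k) chart set \<Rightarrow> 'a set \<Rightarrow> ('a \<Rightarrow> 'b) \<Rightarrow> bool"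
  where "mfd_map P C D W f \<longleftrightarrow> f ` W \<subseteq> points D \<and>
    (\<forall>(U, \<phi>)\<in>C. \<forall>(V, \<psi>)\<in>D.
       let S = \<phi> ` {x \<in> U \<inter> W. f x \<in> V} in open S \<and> P S (\<psi> \<circ> f \<circ> inv_into U \<phi>))"

abbreviation mfd_fun ::
    "('m::topological_space set \<Rightarrow> ('m \<Rightarrow> 'k) \<Rightarrow> bool) \<Rightarrow>
     ('a, 'm) chart set \<Rightarrow> 'a set \<Rightarrow> ('a \<Rightarrow> 'k) \<Rightarrow> bool"
  where "mfd_fun P C W f \<equiv> mfd_map P C {(UNIV, \<lambda>z. z)} W f"

definition prod_atlas ::
    "('a, 'm) chart set \<Rightarrow> ('a \<times> 'f, 'm \<times> 'f) chart set"
  where "prod_atlas C = {(U \<times> UNIV, \<lambda>(x, z). (\<phi> x, z)) |U \<phi>. (U, \<phi>) \<in> C}"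

section \<open>Holomorphic vector bundles\<close>

text \<open>
  The vector space operations are fiberwise; a real structure is obtained by using only the
  scalars in \<open>\<real> \<subseteq> \<complex>\<close>.
\<close>

record ('a, 'e, 'k) vbundle =
  total :: "('e, 'k) chart set"
  proj :: "'e \<Rightarrow> 'a"
  vadd :: "'e \<Rightarrow> 'e \<Rightarrow> 'e"
  vscale :: "complex \<Rightarrow> 'e \<Rightarrow> 'e"
  vzero :: "'a \<Rightarrow> 'e"

definition fiber :: "('a, 'e, 'k) vbundle \<Rightarrow> 'a \<Rightarrow> 'e set"
  where "fiber E x = {e \<in> points (total E). proj E e = x}"

text \<open>
  In \<open>trivialization C E U \<tau>\<close> the map \<open>e \<mapsto> (proj E e, \<tau> e)\<close> is a biholomorphism from the part of
  \<open>E\<close> over \<open>U\<close> onto \<open>U \<times> 'f\<close>, linear on fibers.  The vector space axioms for the fibers follow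
  from the linearity and bijectivity of \<open>\<tau>\<close> on each fiber.
\<close>

definition trivialization ::
    "('a, 'm::complex_euclidean_space) chart set \<Rightarrow>
     ('a, 'e, 'm \<times> 'f::complex_euclidean_space) vbundle \<Rightarrow> 'a set \<Rightarrow> ('e \<Rightarrow> 'f) \<Rightarrow> bool"
  where "trivialization C E U \<tau> \<longleftrightarrow>
    (let EU = {e \<in> points (total E). proj E e \<in> U}; \<Phi> = (\<lambda>e. (proj E e, \<tau> e)) in
      bij_betw \<Phi> EU (U \<times> UNIV) \<and>
      mfd_map holo_on (total E) (prod_atlas C) EU \<Phi> \<and>
      mfd_map holo_on (prod_atlas C) (total E) (U \<times> UNIV) (inv_into EU \<Phi>)) \<and>
    (\<forall>x\<in>U. \<tau> (vzero E x) = 0 \<and>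
      (\<forall>e\<in>fiber E x. \<forall>e'\<in>fiber E x. \<tau> (vadd E e e') = \<tau> e + \<tau> e') \<and>
      (\<forall>c. \<forall>e\<in>fiber E x. \<tau> (vscale E c e) = c *\<^sub>C \<tau> e))"

definition holomorphic_vector_bundle ::
    "('a, 'm::complex_euclidean_space) chart set \<Rightarrow>
     ('a, 'e, 'm \<times> 'f::complex_euclidean_space) vbundle \<Rightarrow> bool"
  where "holomorphic_vector_bundle C E \<longleftrightarrow>
    complex_manifold C \<and> complex_manifold (total E) \<and>
    mfd_map holo_on (total E) C (points (total E)) (proj E) \<and>
    (\<forall>x\<in>points C. vzero E x \<in> fiber E x \<and>
      (\<forall>e\<in>fiber E x. \<forall>e'\<in>fiber E x. vadd E e e' \<in> fiber E x) \<and>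
      (\<forall>c. \<forall>e\<in>fiber E x. vscale E c e \<in> fiber E x)) \<and>
    (\<forall>x\<in>points C. \<exists>U \<tau>. openin (mtop C) U \<and> x \<in> U \<and> trivialization C E U \<tau>)"

text \<open>
  Bundle maps covering the identity of the base, linear over the scalars in \<open>K\<close>
  (\<open>UNIV\<close> for complex and \<open>\<real>\<close> for real bundle maps).
\<close>

definition bundle_map ::
    "('k::topological_space set \<Rightarrow> ('k \<Rightarrow> 'l) \<Rightarrow> bool) \<Rightarrow> complex set \<Rightarrow>
     ('a, 'e, 'k) vbundle \<Rightarrow> ('a, 'h, 'l) vbundle \<Rightarrow> ('e \<Rightarrow> 'h) \<Rightarrow> bool"
  where "bundle_map P K E F \<rho> \<longleftrightarrow>
    mfd_map P (total E) (total F) (points (total E)) \<rho> \<and>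
    (\<forall>e\<in>points (total E). proj F (\<rho> e) = proj E e) \<and>
    (\<forall>x. \<forall>e\<in>fiber E x. \<forall>e'\<in>fiber E x. \<rho> (vadd E e e') = vadd F (\<rho> e) (\<rho> e')) \<and>
    (\<forall>c\<in>K. \<forall>e\<in>points (total E). \<rho> (vscale E c e) = vscale F c (\<rho> e))"

text \<open>
  Sections over \<open>U\<close> of class \<open>P\<close>.  They are made \<^const>\<open>undefined\<close> outside \<open>U\<close>, so that two
  sections over \<open>U\<close> are equal iff they agree on \<open>U\<close>.
\<close>

definition sections ::
    "('m::topological_space set \<Rightarrow> ('m \<Rightarrow> 'k) \<Rightarrow> bool) \<Rightarrow>
     ('a, 'm) chart set \<Rightarrow> ('a, 'e, 'k) vbundle \<Rightarrow> 'a set \<Rightarrow> ('a \<Rightarrow> 'e) set"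
  where "sections P C E U =
    {s \<in> extensional U. (\<forall>x\<in>U. s x \<in> fiber E x) \<and> mfd_map P C (total E) U s}"

definition sec_add :: "('a, 'e, 'k) vbundle \<Rightarrow> 'a set \<Rightarrow> ('a \<Rightarrow> 'e) \<Rightarrow> ('a \<Rightarrow> 'e) \<Rightarrow> 'a \<Rightarrow> 'e"
  where "sec_add E U V W = (\<lambda>x\<in>U. vadd E (V x) (W x))"

definition sec_mult :: "('a, 'e, 'k) vbundle \<Rightarrow> 'a set \<Rightarrow> ('a \<Rightarrow> complex) \<Rightarrow> ('a \<Rightarrow> 'e) \<Rightarrow> 'a \<Rightarrow> 'e"
  where "sec_mult E U f V = (\<lambda>x\<in>U. vscale E (f x) (V x))"

definition sec_zero :: "('a, 'e, 'k) vbundle \<Rightarrow> 'a set \<Rightarrow> 'a \<Rightarrow> 'e"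
  where "sec_zero E U = (\<lambda>x\<in>U. vzero E x)"

section \<open>The tangent bundle\<close>

text \<open>
  A tangent vector at \<open>x\<close> is the family of its coordinates in all charts of the atlas around \<open>x\<close>,
  transforming by the differentials of the coordinate changes.  This describes at the same time the
  holomorphic tangent bundle and the tangent bundle of the underlying real manifold, with the usual
  identification \<open>Z \<mapsto> 2 Re Z\<close> of \<open>T\<^sup>1\<^sup>,\<^sup>0X\<close> with \<open>TX\<close>.
\<close>

type_synonym ('a, 'm) tvec = "'a \<times> (('a, 'm) chart \<Rightarrow> 'm)"

definition charts_at :: "('a, 'm) chart set \<Rightarrow> 'a \<Rightarrow> ('a, 'm) chart set"
  where "charts_at C x = {c \<in> C. x \<in> fst c}"

definition tangent_space :: "('a, 'm::real_normed_vector) chart set \<Rightarrow> 'a \<Rightarrow> ('a, 'm) tvec set"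
  where "tangent_space C x = {(x, v) |v. v \<in> extensional (charts_at C x) \<and>
    (\<forall>(U, \<phi>)\<in>charts_at C x. \<forall>(V, \<psi>)\<in>charts_at C x.
       v (V, \<psi>) = frechet_derivative (\<psi> \<circ> inv_into U \<phi>) (at (\<phi> x)) (v (U, \<phi>)))}"

definition tangent_bundle ::
    "('a, 'm::complex_euclidean_space) chart set \<Rightarrow> ('a, ('a, 'm) tvec, 'm \<times> 'm) vbundle"
  where "tangent_bundle C =
    \<lparr>total = {(\<Union>x\<in>U. tangent_space C x, \<lambda>(x, v). (\<phi> x, v (U, \<phi>))) |U \<phi>. (U, \<phi>) \<in> C},
     proj = fst,
     vadd = (\<lambda>(x, v) (y, w). (x, \<lambda>c\<in>charts_at C x. v c + w c)),
     vscale = (\<lambda>a (x, v). (x, \<lambda>c\<in>charts_at C x. a *\<^sub>C v c)),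
     vzero = (\<lambda>x. (x, \<lambda>c\<in>charts_at C x. 0))\<rparr>"

text \<open>
  The derivative of a (smooth or holomorphic) function along a tangent vector.
  By the chain rule it does not depend on the chosen chart.
\<close>

definition tderiv ::
    "('a, 'm::real_normed_vector) chart set \<Rightarrow> ('a, 'm) tvec \<Rightarrow> ('a \<Rightarrow> 'k::real_normed_vector) \<Rightarrow> 'k"
  where "tderiv C = (\<lambda>(x, v) f. let (U, \<phi>) = (SOME c. c \<in> charts_at C x) in
    frechet_derivative (f \<circ> inv_into U \<phi>) (at (\<phi> x)) (v (U, \<phi>)))"

text \<open>
  The Lie bracket of vector fields, in each chart \<open>[Z, W] = DW(Z) - DZ(W)\<close>; this is the vector field
  acting on functions as the commutator of the derivations \<open>Z\<close> and \<open>W\<close>.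
\<close>

definition vf_bracket ::
    "('a, 'm::real_normed_vector) chart set \<Rightarrow>
     ('a \<Rightarrow> ('a, 'm) tvec) \<Rightarrow> ('a \<Rightarrow> ('a, 'm) tvec) \<Rightarrow> 'a \<Rightarrow> ('a, 'm) tvec"
  where "vf_bracket C Z W x = (x, \<lambda>(U, \<phi>)\<in>charts_at C x.
    let z = (\<lambda>p. snd (Z (inv_into U \<phi> p)) (U, \<phi>));
        w = (\<lambda>p. snd (W (inv_into U \<phi> p)) (U, \<phi>))
    in frechet_derivative w (at (\<phi> x)) (z (\<phi> x)) - frechet_derivative z (at (\<phi> x)) (w (\<phi> x)))"

section \<open>Lie algebroids\<close>

text \<open>
  \<open>br\<close> is a Lie bracket, bilinear over the scalars in \<open>K\<close>, on the space \<open>S\<close> of sections over \<open>U\<close>.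
\<close>

definition lie_bracket_on ::
    "complex set \<Rightarrow> ('a, 'e, 'k) vbundle \<Rightarrow> 'a set \<Rightarrow> ('a \<Rightarrow> 'e) set \<Rightarrow>
     (('a \<Rightarrow> 'e) \<Rightarrow> ('a \<Rightarrow> 'e) \<Rightarrow> 'a \<Rightarrow> 'e) \<Rightarrow> bool"
  where "lie_bracket_on K E U S br \<longleftrightarrow>
    (\<forall>V\<in>S. \<forall>W\<in>S. br V W \<in> S) \<and>
    (\<forall>V\<in>S. \<forall>V'\<in>S. \<forall>W\<in>S. br (sec_add E U V V') W = sec_add E U (br V W) (br V' W)) \<and>
    (\<forall>V\<in>S. \<forall>W\<in>S. \<forall>W'\<in>S. br V (sec_add E U W W') = sec_add E U (br V W) (br V W')) \<and>
    (\<forall>c\<in>K. \<forall>V\<in>S. \<forall>W\<in>S. br (sec_mult E U (\<lambda>_. c) V) W = sec_mult E U (\<lambda>_. c) (br V W)) \<and>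
    (\<forall>c\<in>K. \<forall>V\<in>S. \<forall>W\<in>S. br V (sec_mult E U (\<lambda>_. c) W) = sec_mult E U (\<lambda>_. c) (br V W)) \<and>
    (\<forall>V\<in>S. br V V = sec_zero E U) \<and>
    (\<forall>V\<in>S. \<forall>W\<in>S. \<forall>Z\<in>S.
       sec_add E U (br V (br W Z)) (sec_add E U (br W (br Z V)) (br Z (br V W))) = sec_zero E U)"

text \<open>
  The bracket of a holomorphic Lie algebroid is a family \<open>br U\<close> indexed by the open sets \<open>U\<close> of the
  base, compatible with restrictions.
\<close>

definition holomorphic_lie_algebroid ::
    "('a, 'm::complex_euclidean_space) chart set \<Rightarrow>
     ('a, 'e, 'm \<times> 'f::complex_euclidean_space) vbundle \<Rightarrow> ('e \<Rightarrow> ('a, 'm) tvec) \<Rightarrow>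
     ('a set \<Rightarrow> ('a \<Rightarrow> 'e) \<Rightarrow> ('a \<Rightarrow> 'e) \<Rightarrow> 'a \<Rightarrow> 'e) \<Rightarrow> bool"
  where "holomorphic_lie_algebroid C E \<rho> br \<longleftrightarrow>
    holomorphic_vector_bundle C E \<and>
    bundle_map holo_on UNIV E (tangent_bundle C) \<rho> \<and>
    (\<forall>U. openin (mtop C) U \<longrightarrow> lie_bracket_on UNIV E U (sections holo_on C E U) (br U)) \<and>
    (\<forall>U U'. openin (mtop C) U \<longrightarrow> openin (mtop C) U' \<longrightarrow> U' \<subseteq> U \<longrightarrow>
      (\<forall>V\<in>sections holo_on C E U. \<forall>W\<in>sections holo_on C E U.
         restrict (br U V W) U' = br U' (restrict V U') (restrict W U'))) \<and>
    (\<forall>U. openin (mtop C) U \<longrightarrow>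
      (\<forall>V\<in>sections holo_on C E U. \<forall>W\<in>sections holo_on C E U. \<forall>x\<in>U.
         \<rho> (br U V W x) = vf_bracket C (\<rho> \<circ> V) (\<rho> \<circ> W) x)) \<and>
    (\<forall>U. openin (mtop C) U \<longrightarrow>
      (\<forall>V\<in>sections holo_on C E U. \<forall>W\<in>sections holo_on C E U. \<forall>f. mfd_fun holo_on C U f \<longrightarrow>
         br U V (sec_mult E U f W) =
           sec_add E U (sec_mult E U (\<lambda>x. tderiv C (\<rho> (V x)) f) W) (sec_mult E U f (br U V W))))"

text \<open>
  A real Lie algebroid structure, with anchor \<open>\<rho>\<close> and bracket \<open>br\<close> on global smooth sections, on the
  smooth real vector bundle underlying \<open>E\<close>.
\<close>

definition real_lie_algebroid ::
    "('a, 'm::complex_euclidean_space) chart set \<Rightarrow>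
     ('a, 'e, 'm \<times> 'f::complex_euclidean_space) vbundle \<Rightarrow> ('e \<Rightarrow> ('a, 'm) tvec) \<Rightarrow>
     (('a \<Rightarrow> 'e) \<Rightarrow> ('a \<Rightarrow> 'e) \<Rightarrow> 'a \<Rightarrow> 'e) \<Rightarrow> bool"
  where "real_lie_algebroid C E \<rho> br \<longleftrightarrow>
    (let X = points C; \<Gamma> = sections smooth_on C E X in
      bundle_map smooth_on \<real> E (tangent_bundle C) \<rho> \<and>
      lie_bracket_on \<real> E X \<Gamma> br \<and>
      (\<forall>V\<in>\<Gamma>. \<forall>W\<in>\<Gamma>. \<forall>x\<in>X. \<rho> (br V W x) = vf_bracket C (\<rho> \<circ> V) (\<rho> \<circ> W) x) \<and>
      (\<forall>V\<in>\<Gamma>. \<forall>W\<in>\<Gamma>. \<forall>f::'a \<Rightarrow> real. mfd_fun smooth_on C X f \<longrightarrow>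
         br V (sec_mult E X (\<lambda>x. of_real (f x)) W) =
           sec_add E X (sec_mult E X (\<lambda>x. of_real (tderiv C (\<rho> (V x)) f)) W)
                       (sec_mult E X (\<lambda>x. of_real (f x)) (br V W))))"

text \<open>
  The bracket of smooth sections of a real Lie algebroid is local; that it extends the bracket of
  holomorphic sections over open sets therefore means that both agree wherever the arguments are
  locally holomorphic.
\<close>

definition underlying_real_lie_algebroid ::
    "('a, 'm::complex_euclidean_space) chart set \<Rightarrow>
     ('a, 'e, 'm \<times> 'f::complex_euclidean_space) vbundle \<Rightarrow> ('e \<Rightarrow> ('a, 'm) tvec) \<Rightarrow>
     ('a set \<Rightarrow> ('a \<Rightarrow> 'e) \<Rightarrow> ('a \<Rightarrow> 'e) \<Rightarrow> 'a \<Rightarrow> 'e) \<Rightarrow>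
     (('a \<Rightarrow> 'e) \<Rightarrow> ('a \<Rightarrow> 'e) \<Rightarrow> 'a \<Rightarrow> 'e) \<Rightarrow> bool"
  where "underlying_real_lie_algebroid C E \<rho> br brR \<longleftrightarrow>
    real_lie_algebroid C E \<rho> brR \<and>
    (\<forall>U. openin (mtop C) U \<longrightarrow>
      (\<forall>V\<in>sections smooth_on C E (points C). \<forall>W\<in>sections smooth_on C E (points C).
         restrict V U \<in> sections holo_on C E U \<longrightarrow> restrict W U \<in> sections holo_on C E U \<longrightarrow>
         restrict (brR V W) U = br U (restrict V U) (restrict W U)))"

definition nijenhuis_torsion ::
    "('a, 'm) chart set \<Rightarrow> ('a, 'e, 'k) vbundle \<Rightarrow> (('a \<Rightarrow> 'e) \<Rightarrow> ('a \<Rightarrow> 'e) \<Rightarrow> 'a \<Rightarrow> 'e) \<Rightarrow>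
     ('e \<Rightarrow> 'e) \<Rightarrow> ('a \<Rightarrow> 'e) \<Rightarrow> ('a \<Rightarrow> 'e) \<Rightarrow> 'a \<Rightarrow> 'e"
  where "nijenhuis_torsion C E br j V W =
    (let X = points C;
         J = (\<lambda>s. \<lambda>x\<in>X. j (s x));
         add = sec_add E X;
         neg = sec_mult E X (\<lambda>_. - 1)
     in add (br (J V) (J W))
          (neg (J (add (add (br (J V) W) (br V (J W))) (neg (J (br V W)))))))"

end

theory Submission
  imports Defs
begin

text \<open>
  The torsion \<open>N(V, W) = [jV, jW] - j([jV, W] + [V, jW] - j[V, W])\<close> is tensorial: by the Leibniz rule
  it commutes with multiplication of \<open>V\<close> or \<open>W\<close> by real smooth functions
  (\<open>torsion_times_coord\<close>, together with the antisymmetry \<open>torsion_swap_coord\<close>), because the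
  terms in which the function is differentiated cancel.  Hence \<open>N(V, W)\<close> vanishes at a point as soon as
  \<open>N\<close> vanishes there on pairs of sections from a real frame (\<open>torsion_zero_of_frame\<close>).

  Such a frame may be chosen holomorphic near the given point: the constant sections of a holomorphic
  trivialization, for all vectors of a real basis of the model fiber.  On holomorphic
  sections the bracket is the complex bilinear one of the holomorphic Lie algebroid, multiplication by
  \<open>\<i>\<close> preserves these constant sections, and all four terms of \<open>N\<close> become multiples of the same
  vector, with coefficients that cancel (\<open>torsion_zero_of_complex_bilinear\<close>).

  The bracket of the real Lie algebroid only takes globally defined sections, so the frame has to be cut off
  by a smooth function that equals \<open>1\<close> near the point (\<open>manifold_bump_exists\<close>).
  Most of what precedes the computation with \<open>N\<close> establishes that such functions exist, and that
  sections built from smooth coordinates in a trivialization are smooth; this rests on the chain and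
  product rules for the iterated directional derivatives by which smoothness is defined.
\<close>

section \<open>Calculus on finite-dimensional spaces\<close>

lemma frechet_derivativeI:
  assumes "(f has_derivative f') (at p)"
  shows "f differentiable (at p)" "frechet_derivative f (at p) = f'"
proof -
  show "f differentiable (at p)" using assms by (rule differentiableI)
  show "frechet_derivative f (at p) = f'" using frechet_derivative_at[OF assms] by simp
qed

lemma Ck_on_cong:
  assumes "open S" "\<And>p. p \<in> S \<Longrightarrow> f p = g p" "Ck_on k S f"
  shows "Ck_on k S g"
  using assms
proof (induction k arbitrary: f g)
  case 0
  then show ?case using continuous_on_cong[of S S f g] by simp
next
  case (Suc k)
  have D: "(g has_derivative frechet_derivative f (at p)) (at p)" if "p \<in> S" for p
  proof (rule has_derivative_transform_within_open[OF _ Suc.prems(1) that Suc.prems(2)])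
    show "(f has_derivative frechet_derivative f (at p)) (at p)"
      using Suc.prems(3) that by (simp add: frechet_derivative_works)
  qed
  have "Ck_on k S (\<lambda>p. frechet_derivative g (at p) v)" for v
  proof (rule Suc.IH[OF Suc.prems(1)])
    show "frechet_derivative f (at p) v = frechet_derivative g (at p) v" if "p \<in> S" for p
      using frechet_derivativeI(2)[OF D[OF that]] by simp
    show "Ck_on k S (\<lambda>p. frechet_derivative f (at p) v)"
      using Suc.prems(3) by simp
  qed
  then show ?case using frechet_derivativeI(1)[OF D] by simp
qed

lemma Ck_on_subset: "Ck_on k S f \<Longrightarrow> T \<subseteq> S \<Longrightarrow> Ck_on k T f"
proof (induction k arbitrary: f)
  case (Suc k)
  then have "Ck_on k T (\<lambda>p. frechet_derivative f (at p) v)" for v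
    by (intro Suc.IH) simp_all
  then show ?case using Suc.prems by (simp add: subset_iff)
next
  case 0
  then show ?case unfolding Ck_on.simps by (rule continuous_on_subset)
qed

lemma Ck_on_local:
  assumes "\<And>p. p \<in> S \<Longrightarrow> \<exists>T. open T \<and> p \<in> T \<and> Ck_on k T f"
  shows "Ck_on k S f"
  using assms
proof (induction k arbitrary: f)
  case 0
  show ?case unfolding Ck_on.simps
  proof (rule continuous_at_imp_continuous_on, rule ballI)
    fix p assume "p \<in> S"
    then show "isCont f p"
      using 0[of p] by (auto simp: continuous_on_eq_continuous_at)
  qed
next
  case (Suc k)
  have "Ck_on k S (\<lambda>p. frechet_derivative f (at p) v)" for v
  proof (rule Suc.IH)
    fix p assume "p \<in> S"
    then obtain T where "open T" "p \<in> T" "Ck_on (Suc k) T f"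
      using Suc.prems by blast
    then show "\<exists>T. open T \<and> p \<in> T \<and> Ck_on k T (\<lambda>p. frechet_derivative f (at p) v)"
      by (intro exI[of _ T]) simp
  qed
  moreover have "f differentiable (at p)" if "p \<in> S" for p
    using Suc.prems[OF that] by auto
  ultimately show ?case by simp
qed

lemma Ck_on_Suc_D: "Ck_on (Suc k) S f \<Longrightarrow> Ck_on k S f"
proof (induction k arbitrary: f)
  case 0
  then show ?case
    by (auto intro!: continuous_at_imp_continuous_on differentiable_imp_continuous_within)
next
  case (Suc k)
  then have "Ck_on k S (\<lambda>p. frechet_derivative f (at p) v)" for v
    by (intro Suc.IH) simp
  then show ?case using Suc.prems by simp
qed

lemma Ck_on_SucI:
  assumes "open S" "\<And>p. p \<in> S \<Longrightarrow> (f has_derivative f' p) (at p)"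
    and "\<And>v. Ck_on k S (\<lambda>p. f' p v)"
  shows "Ck_on (Suc k) S f"
proof -
  have "Ck_on k S (\<lambda>p. frechet_derivative f (at p) v)" for v
    by (rule Ck_on_cong[OF assms(1) _ assms(3)[of v]])
      (simp add: frechet_derivativeI(2)[OF assms(2)])
  then show ?thesis using frechet_derivativeI(1)[OF assms(2)] by simp
qed

lemma Ck_on_SucD:
  assumes "Ck_on (Suc k) S f"
  shows "p \<in> S \<Longrightarrow> (f has_derivative frechet_derivative f (at p)) (at p)"
    and "Ck_on k S (\<lambda>p. frechet_derivative f (at p) v)"
  using assms by (simp_all add: frechet_derivative_works)

lemma Ck_on_const: "Ck_on k S (\<lambda>p. c)"
proof (induction k arbitrary: c)
  case (Suc k)
  show ?case
    using Suc.IH[of 0] by (simp add: frechet_derivative_const del: Suc.IH)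
qed simp

lemma Ck_on_linear:
  assumes "bounded_linear L" "open S" "Ck_on k S f"
  shows "Ck_on k S (\<lambda>p. L (f p))"
  using assms(3)
proof (induction k arbitrary: f)
  case 0
  then show ?case unfolding Ck_on.simps by (rule bounded_linear.continuous_on[OF assms(1)])
next
  case (Suc k)
  show ?case
  proof (rule Ck_on_SucI[OF assms(2)])
    show "((\<lambda>p. L (f p)) has_derivative (\<lambda>v. L (frechet_derivative f (at p) v))) (at p)"
      if "p \<in> S" for p
      by (rule bounded_linear.has_derivative[OF assms(1) Ck_on_SucD(1)[OF Suc.prems that]])
    show "Ck_on k S (\<lambda>p. L (frechet_derivative f (at p) v))" for v
      by (rule Suc.IH[OF Ck_on_SucD(2)[OF Suc.prems]])
  qed
qed

lemma Ck_on_add: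
  assumes "open S" "Ck_on k S f" "Ck_on k S g"
  shows "Ck_on k S (\<lambda>p. f p + g p)"
  using assms(2,3)
proof (induction k arbitrary: f g)
  case 0
  then show ?case unfolding Ck_on.simps by (rule continuous_on_add)
next
  case (Suc k)
  show ?case
  proof (rule Ck_on_SucI[OF assms(1)])
    show "((\<lambda>p. f p + g p) has_derivative
        (\<lambda>v. frechet_derivative f (at p) v + frechet_derivative g (at p) v)) (at p)"
      if "p \<in> S" for p
      by (rule has_derivative_add[OF Suc.prems[THEN Ck_on_SucD(1), OF that]])
    show "Ck_on k S (\<lambda>p. frechet_derivative f (at p) v + frechet_derivative g (at p) v)" for v
      by (rule Suc.IH[OF Suc.prems[THEN Ck_on_SucD(2)]])
  qed
qed

lemma Ck_on_bilinear:
  assumes "bounded_bilinear B" "open S" "Ck_on k S f" "Ck_on k S g"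
  shows "Ck_on k S (\<lambda>p. B (f p) (g p))"
  using assms(3,4)
proof (induction k arbitrary: f g)
  case 0
  then show ?case unfolding Ck_on.simps by (rule bounded_bilinear.continuous_on[OF assms(1)])
next
  case (Suc k)
  show ?case
  proof (rule Ck_on_SucI[OF assms(2)])
    show "((\<lambda>p. B (f p) (g p)) has_derivative
        (\<lambda>v. B (f p) (frechet_derivative g (at p) v) + B (frechet_derivative f (at p) v) (g p)))
        (at p)" if "p \<in> S" for p
      by (rule bounded_bilinear.FDERIV[OF assms(1) Suc.prems[THEN Ck_on_SucD(1), OF that]])
    show "Ck_on k S (\<lambda>p. B (f p) (frechet_derivative g (at p) v)
        + B (frechet_derivative f (at p) v) (g p))" for v
      by (rule Ck_on_add[OF assms(2)
            Suc.IH[OF Ck_on_Suc_D[OF Suc.prems(1)] Ck_on_SucD(2)[OF Suc.prems(2)]]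
            Suc.IH[OF Ck_on_SucD(2)[OF Suc.prems(1)] Ck_on_Suc_D[OF Suc.prems(2)]]])
  qed
qed

lemma Ck_on_sum:
  assumes "open S" "\<And>i. i \<in> I \<Longrightarrow> Ck_on k S (f i)"
  shows "Ck_on k S (\<lambda>p. \<Sum>i\<in>I. f i p)"
  using assms(2)
proof (induction I rule: infinite_finite_induct)
  case (insert i I)
  have "Ck_on k S (\<lambda>p. f i p + (\<Sum>i\<in>I. f i p))"
    by (rule Ck_on_add[OF assms(1)]) (use insert in auto)
  then show ?case using insert.hyps by simp
qed (simp_all add: Ck_on_const)

lemma Ck_on_Pair:
  assumes "open S" "Ck_on k S f" "Ck_on k S g"
  shows "Ck_on k S (\<lambda>p. (f p, g p))"
  using assms(2,3)
proof (induction k arbitrary: f g)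
  case 0
  then show ?case unfolding Ck_on.simps by (rule continuous_on_Pair)
next
  case (Suc k)
  show ?case
  proof (rule Ck_on_SucI[OF assms(1)])
    show "((\<lambda>p. (f p, g p)) has_derivative
        (\<lambda>v. (frechet_derivative f (at p) v, frechet_derivative g (at p) v))) (at p)"
      if "p \<in> S" for p
      by (rule has_derivative_Pair[OF Suc.prems[THEN Ck_on_SucD(1), OF that]])
    show "Ck_on k S (\<lambda>p. (frechet_derivative f (at p) v, frechet_derivative g (at p) v))" for v
      by (rule Suc.IH[OF Suc.prems[THEN Ck_on_SucD(2)]])
  qed
qed

text \<open>
  A finite spanning family \<open>b\<close> with a choice of bounded linear coefficient functions \<open>l\<close>.  The data
  are explicit so that the notion covers both \<open>\<real>\<close> and the model spaces.
\<close>

definition coordinate_system ::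
    "'b set \<Rightarrow> ('b \<Rightarrow> 'a::real_normed_vector \<Rightarrow> real) \<Rightarrow> ('b \<Rightarrow> 'a) \<Rightarrow> bool"
  where "coordinate_system B l b \<longleftrightarrow> finite B \<and> (\<forall>i\<in>B. bounded_linear (l i)) \<and>
    (\<forall>x. (\<Sum>i\<in>B. l i x *\<^sub>R b i) = x)"

lemma coordinate_system_real: "coordinate_system {()} (\<lambda>_ x. x) (\<lambda>_. 1::real)"
  by (simp add: coordinate_system_def bounded_linear_ident)

text \<open>
  Gram--Schmidt, applied to a finite set that separates the points, gives a finite orthogonal set
  that still separates them; a vector and its orthogonal expansion then have the same inner products
  with that set.
\<close>

lemma coordinate_system_exists:
  "\<exists>B l b. coordinate_system (B :: 'a set) l (b :: 'a \<Rightarrow> 'a::complex_euclidean_space)"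
proof -
  obtain B :: "'a set" where B: "finite B" "\<And>x. (\<forall>b\<in>B. inner x b = 0) \<Longrightarrow> x = 0"
    using finite_dimensional by blast
  obtain D where D: "finite D" "span D = span B" "pairwise orthogonal D"
    using basis_orthogonal[OF B(1)] by blast
  have "(\<Sum>d\<in>D. (inner x d / inner d d) *\<^sub>R d) = x" for x :: 'a
  proof -
    let ?y = "x - (\<Sum>d\<in>D. (inner x d / inner d d) *\<^sub>R d)"
    have "orthogonal ?y d" if "d \<in> D" for d
    proof -
      have "inner (\<Sum>d\<in>D. (inner x d / inner d d) *\<^sub>R d) d
          = (\<Sum>c\<in>D. if c = d then inner x d else 0)"
        unfolding inner_sum_left
        by (rule sum.cong) (use D(3) that in \<open>auto simp: pairwise_def orthogonal_def\<close>)
      then show ?thesis using D(1) that by (simp add: orthogonal_def inner_diff_left)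
    qed
    then have "orthogonal ?y b" if "b \<in> span D" for b
      using orthogonal_to_span[OF that] by blast
    then have "\<forall>b\<in>B. inner ?y b = 0"
      using D(2) span_base by (metis orthogonal_def)
    then show ?thesis using B(2)[of ?y] by simp
  qed
  moreover have "bounded_linear (\<lambda>x. inner x d / inner d d)" for d :: 'a
    using bounded_linear_compose[OF bounded_linear_mult_left[of "inverse (inner d d)"]
        bounded_linear_inner_left[of d]]
    by (simp add: divide_inverse)
  ultimately have "coordinate_system D (\<lambda>d x. inner x d / inner d d) (\<lambda>d. d)"
    unfolding coordinate_system_def using D(1) by blast
  then show ?thesis by blast
qed

lemma bounded_linear_of_linear:
  fixes L :: "'a::complex_euclidean_space \<Rightarrow> 'b::real_normed_vector"
  assumes "linear L"
  shows "bounded_linear L"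
proof -
  obtain B :: "'a set" and l and b :: "'a \<Rightarrow> 'a" where c: "coordinate_system B l b"
    using coordinate_system_exists by blast
  have "L x = (\<Sum>i\<in>B. l i x *\<^sub>R L (b i))" for x
  proof -
    have "L x = L (\<Sum>i\<in>B. l i x *\<^sub>R b i)" using c by (simp add: coordinate_system_def)
    then show ?thesis by (simp add: linear_sum[OF assms] linear_scale[OF assms])
  qed
  then have "L = (\<lambda>x. \<Sum>i\<in>B. l i x *\<^sub>R L (b i))" by blast
  moreover have "bounded_linear (\<lambda>x. \<Sum>i\<in>B. l i x *\<^sub>R L (b i))"
    using c by (intro bounded_linear_sum bounded_linear_scaleR_const)
      (auto simp: coordinate_system_def)
  ultimately show ?thesis by simp
qed

text \<open>
  The derivative of \<open>g \<circ> f\<close> in the direction \<open>v\<close> is the derivative of \<open>g\<close> in the direction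
  \<open>Df(p) v\<close>, which varies with \<open>p\<close>, while the recursion of \<^const>\<open>Ck_on\<close> speaks about derivatives in
  constant directions only.  Expanding \<open>Df(p) v\<close> in coordinates turns it into a finite sum of products
  of functions to which the induction hypothesis applies; this is where finite dimension enters.
\<close>

lemma Ck_on_compose:
  fixes f :: "'m::real_normed_vector \<Rightarrow> 'n::real_normed_vector"
    and l :: "'i \<Rightarrow> 'n \<Rightarrow> real"
  assumes co: "coordinate_system B l b"
    and "open S" "open T" "f ` S \<subseteq> T" "Ck_on k S f" "Ck_on k T g"
  shows "Ck_on k S (\<lambda>p. g (f p))"
  using assms(5,6)
proof (induction k arbitrary: g)
  case 0
  then show ?case
    using continuous_on_compose2[of T g S f] \<open>f ` S \<subseteq> T\<close> by simp
next
  case (Suc k)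
  have fin: "finite B" and bl: "\<And>i. i \<in> B \<Longrightarrow> bounded_linear (l i)"
    and ex: "\<And>x. (\<Sum>i\<in>B. l i x *\<^sub>R b i) = x"
    using co unfolding coordinate_system_def by blast+
  let ?f' = "\<lambda>p. frechet_derivative f (at p)" and ?g' = "\<lambda>q. frechet_derivative g (at q)"
  let ?D = "\<lambda>p v. \<Sum>i\<in>B. l i (?f' p v) *\<^sub>R ?g' (f p) (b i)"
  have D: "((\<lambda>p. g (f p)) has_derivative ?D p) (at p)" if "p \<in> S" for p
  proof -
    have "f p \<in> T" using that \<open>f ` S \<subseteq> T\<close> by blast
    have lin: "linear (?g' (f p))"
      using Ck_on_SucD(1)[OF Suc.prems(2) \<open>f p \<in> T\<close>] has_derivative_linear by blast
    have "?g' (f p) (\<Sum>i\<in>B. l i w *\<^sub>R b i) = (\<Sum>i\<in>B. l i w *\<^sub>R ?g' (f p) (b i))" for w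
      by (simp add: linear_sum[OF lin] linear_scale[OF lin])
    from this[unfolded ex] have D: "?g' (f p) \<circ> ?f' p = ?D p"
      unfolding o_def by (intro ext) blast
    show ?thesis
      using diff_chain_at[OF Ck_on_SucD(1)[OF Suc.prems(1) that]
          Ck_on_SucD(1)[OF Suc.prems(2) \<open>f p \<in> T\<close>]]
      unfolding D by (simp only: o_def)
  qed
  show ?case
  proof (rule Ck_on_SucI[OF \<open>open S\<close> D])
    fix v
    show "Ck_on k S (\<lambda>p. ?D p v)"
    proof (rule Ck_on_sum[OF \<open>open S\<close>])
      fix i assume "i \<in> B"
      have "Ck_on k S (\<lambda>p. l i (?f' p v))"
        by (rule Ck_on_linear[OF bl[OF \<open>i \<in> B\<close>] \<open>open S\<close> Ck_on_SucD(2)[OF Suc.prems(1)]])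
      moreover have "Ck_on k S (\<lambda>p. ?g' (f p) (b i))"
        by (rule Suc.IH[OF Ck_on_Suc_D[OF Suc.prems(1)] Ck_on_SucD(2)[OF Suc.prems(2)]])
      ultimately show "Ck_on k S (\<lambda>p. l i (?f' p v) *\<^sub>R ?g' (f p) (b i))"
        by (rule Ck_on_bilinear[OF bounded_bilinear_scaleR \<open>open S\<close>])
    qed
  qed
qed

lemma smooth_on_cong:
  assumes "smooth_on S f" "open S" "\<And>p. p \<in> S \<Longrightarrow> f p = g p"
  shows "smooth_on S g"
  using assms(1) Ck_on_cong[of S f g, OF assms(2,3)] unfolding smooth_on_def by blast

lemma smooth_on_subset: "smooth_on S f \<Longrightarrow> T \<subseteq> S \<Longrightarrow> smooth_on T f"
  unfolding smooth_on_def using Ck_on_subset by blast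

lemma smooth_on_local:
  assumes "\<And>p. p \<in> S \<Longrightarrow> \<exists>T. open T \<and> p \<in> T \<and> smooth_on T f"
  shows "smooth_on S f"
  unfolding smooth_on_def
proof
  show "Ck_on k S f" for k by (rule Ck_on_local) (use assms smooth_on_def in blast)
qed

lemma smooth_on_continuous: "smooth_on S f \<Longrightarrow> continuous_on S f"
  unfolding smooth_on_def by (metis Ck_on.simps(1))

lemma smooth_on_has_derivative:
  "smooth_on S f \<Longrightarrow> p \<in> S \<Longrightarrow> (f has_derivative frechet_derivative f (at p)) (at p)"
  unfolding smooth_on_def using Ck_on_SucD(1) by blast

lemma smooth_on_const: "smooth_on S (\<lambda>p. c)"
  by (simp add: smooth_on_def Ck_on_const)

lemma smooth_on_id: "open S \<Longrightarrow> smooth_on S (\<lambda>p. p)"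
  unfolding smooth_on_def
proof
  show "Ck_on k S (\<lambda>p. p)" if "open S" for k
  proof (cases k)
    case (Suc n)
    show ?thesis unfolding Suc
      by (rule Ck_on_SucI[OF that, of _ "\<lambda>_ v. v"]) (simp_all add: Ck_on_const)
  qed simp
qed

lemma smooth_on_linear:
  "bounded_linear L \<Longrightarrow> open S \<Longrightarrow> smooth_on S f \<Longrightarrow> smooth_on S (\<lambda>p. L (f p))"
  unfolding smooth_on_def by (intro allI, rule Ck_on_linear) simp_all

lemma smooth_on_add:
  "open S \<Longrightarrow> smooth_on S f \<Longrightarrow> smooth_on S g \<Longrightarrow> smooth_on S (\<lambda>p. f p + g p)"
  unfolding smooth_on_def by (intro allI, rule Ck_on_add) simp_all

lemma smooth_on_bilinear:
  "bounded_bilinear B \<Longrightarrow> open S \<Longrightarrow> smooth_on S f \<Longrightarrow> smooth_on S g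
    \<Longrightarrow> smooth_on S (\<lambda>p. B (f p) (g p))"
  unfolding smooth_on_def by (intro allI, rule Ck_on_bilinear) simp_all

lemma smooth_on_Pair:
  "open S \<Longrightarrow> smooth_on S f \<Longrightarrow> smooth_on S g \<Longrightarrow> smooth_on S (\<lambda>p. (f p, g p))"
  unfolding smooth_on_def by (intro allI, rule Ck_on_Pair) simp_all

lemma smooth_on_compose:
  fixes f :: "'m::real_normed_vector \<Rightarrow> 'n::complex_euclidean_space"
  assumes "open S" "open T" "smooth_on S f" "smooth_on T g" "f ` S \<subseteq> T"
  shows "smooth_on S (g \<circ> f)"
proof -
  obtain B :: "'n set" and l and b :: "'n \<Rightarrow> 'n" where c: "coordinate_system B l b"
    using coordinate_system_exists by blast
  have "Ck_on k S (\<lambda>p. g (f p))" for k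
    by (rule Ck_on_compose[OF c assms(1,2,5)]) (use assms(3,4) in \<open>simp_all add: smooth_on_def\<close>)
  then show ?thesis by (simp add: smooth_on_def o_def)
qed

lemma smooth_on_compose_real:
  fixes f :: "'m::real_normed_vector \<Rightarrow> real"
  assumes "open S" "open T" "smooth_on S f" "smooth_on T g" "f ` S \<subseteq> T"
  shows "smooth_on S (g \<circ> f)"
proof -
  have "Ck_on k S (\<lambda>p. g (f p))" for k
    by (rule Ck_on_compose[OF coordinate_system_real assms(1,2,5)])
      (use assms(3,4) in \<open>simp_all add: smooth_on_def\<close>)
  then show ?thesis by (simp add: smooth_on_def o_def)
qed

lemma scaleC_zero_right: "c *\<^sub>C (0::'a::complex_euclidean_space) = 0"
  using scaleC_add_right[of c 0 "0::'a"] by simp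

lemma scaleC_minus_one: "(- 1) *\<^sub>C (x::'a::complex_euclidean_space) = - x"
  using scaleC_of_real[of "-1" x] by simp

lemma scaleC_scaleR_commute:
  "c *\<^sub>C (r *\<^sub>R x) = r *\<^sub>R (c *\<^sub>C (x::'a::complex_euclidean_space))"
  by (simp add: scaleC_scaleC mult.commute flip: scaleC_of_real)

lemma bounded_linear_scaleC: "bounded_linear (\<lambda>x::'a::complex_euclidean_space. c *\<^sub>C x)"
  by (rule bounded_linear_of_linear, rule linearI)
    (simp_all add: scaleC_add_right scaleC_scaleR_commute)

lemma scaleC_minus_right: "c *\<^sub>C (- x) = - (c *\<^sub>C (x::'a::complex_euclidean_space))"
  using linear_neg[OF bounded_linear.linear[OF bounded_linear_scaleC]] .

lemma scaleC_diff_right: "c *\<^sub>C (x - y) = c *\<^sub>C x - c *\<^sub>C (y::'a::complex_euclidean_space)"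
  using linear_diff[OF bounded_linear.linear[OF bounded_linear_scaleC]] .

lemma holo_on_smooth_on: "holo_on S f \<Longrightarrow> smooth_on S f"
  by (simp add: holo_on_def)

text \<open>
  Complex linearity of any one Frechet derivative suffices, since derivatives are unique.
\<close>

lemma holo_on_iff:
  "holo_on S f \<longleftrightarrow> smooth_on S f \<and>
    (\<forall>p\<in>S. \<exists>f'. (f has_derivative f') (at p) \<and> (\<forall>c v. f' (c *\<^sub>C v) = c *\<^sub>C f' v))"
proof
  assume "holo_on S f"
  then show "smooth_on S f \<and>
    (\<forall>p\<in>S. \<exists>f'. (f has_derivative f') (at p) \<and> (\<forall>c v. f' (c *\<^sub>C v) = c *\<^sub>C f' v))"
    unfolding holo_on_def using smooth_on_has_derivative by blast
next
  assume R: "smooth_on S f \<and>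
    (\<forall>p\<in>S. \<exists>f'. (f has_derivative f') (at p) \<and> (\<forall>c v. f' (c *\<^sub>C v) = c *\<^sub>C f' v))"
  have "frechet_derivative f (at p) (c *\<^sub>C v) = c *\<^sub>C frechet_derivative f (at p) v"
    if p: "p \<in> S" for p c v
  proof -
    obtain f' where "(f has_derivative f') (at p)" "\<forall>c v. f' (c *\<^sub>C v) = c *\<^sub>C f' v"
      using R p by blast
    then show ?thesis using frechet_derivativeI(2)[of f f' p] by simp
  qed
  then show "holo_on S f" using R unfolding holo_on_def by blast
qed

lemma holo_on_cong:
  assumes "holo_on S f" "open S" "\<And>p. p \<in> S \<Longrightarrow> f p = g p"
  shows "holo_on S g"
  unfolding holo_on_iff
proof (intro conjI ballI)
  show "smooth_on S g"
    by (rule smooth_on_cong[OF holo_on_smooth_on[OF assms(1)] assms(2,3)])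
  fix p assume "p \<in> S"
  then obtain f' where "(f has_derivative f') (at p)" "\<forall>c v. f' (c *\<^sub>C v) = c *\<^sub>C f' v"
    using assms(1,2) unfolding holo_on_iff by blast
  moreover from this(1) have "(g has_derivative f') (at p)"
    by (rule has_derivative_transform_within_open[OF _ \<open>open S\<close> \<open>p \<in> S\<close> assms(3)])
  ultimately show "\<exists>d. (g has_derivative d) (at p) \<and> (\<forall>c v. d (c *\<^sub>C v) = c *\<^sub>C d v)"
    by blast
qed

lemma holo_on_subset: "holo_on S f \<Longrightarrow> T \<subseteq> S \<Longrightarrow> holo_on T f"
  unfolding holo_on_def using smooth_on_subset by blast

lemma holo_on_local:
  assumes "\<And>p. p \<in> S \<Longrightarrow> \<exists>T. open T \<and> p \<in> T \<and> holo_on T f"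
  shows "holo_on S f"
  unfolding holo_on_def
proof
  show "smooth_on S f" by (rule smooth_on_local) (use assms holo_on_smooth_on in blast)
  show "\<forall>p\<in>S. \<forall>c v. frechet_derivative f (at p) (c *\<^sub>C v) = c *\<^sub>C frechet_derivative f (at p) v"
    using assms unfolding holo_on_def by blast
qed

lemma holo_on_compose:
  assumes "open S" "open T" "holo_on S f" "holo_on T g" "f ` S \<subseteq> T"
  shows "holo_on S (g \<circ> f)"
  unfolding holo_on_iff
proof (intro conjI ballI)
  show "smooth_on S (g \<circ> f)"
    by (rule smooth_on_compose[OF assms(1,2) assms(3,4)[THEN holo_on_smooth_on] assms(5)])
  fix p assume "p \<in> S"
  obtain f' where f: "(f has_derivative f') (at p)" "\<And>c v. f' (c *\<^sub>C v) = c *\<^sub>C f' v"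
    using assms(3) \<open>p \<in> S\<close> unfolding holo_on_iff by blast
  have "f p \<in> T" using assms(5) \<open>p \<in> S\<close> by blast
  then obtain g' where g: "(g has_derivative g') (at (f p))" "\<And>c v. g' (c *\<^sub>C v) = c *\<^sub>C g' v"
    using assms(4) unfolding holo_on_iff by blast
  show "\<exists>d. (g \<circ> f has_derivative d) (at p) \<and> (\<forall>c v. d (c *\<^sub>C v) = c *\<^sub>C d v)"
  proof (intro exI conjI allI)
    show "(g \<circ> f has_derivative g' \<circ> f') (at p)" by (rule diff_chain_at[OF f(1) g(1)])
  qed (simp add: f(2) g(2))
qed

lemma holo_on_Pair:
  assumes "open S" "holo_on S f" "holo_on S g"
  shows "holo_on S (\<lambda>p. (f p, g p))"
  unfolding holo_on_iff
proof (intro conjI ballI)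
  show "smooth_on S (\<lambda>p. (f p, g p))"
    by (rule smooth_on_Pair[OF assms(1) assms(2,3)[THEN holo_on_smooth_on]])
  fix p assume "p \<in> S"
  obtain f' where f: "(f has_derivative f') (at p)" "\<And>c v. f' (c *\<^sub>C v) = c *\<^sub>C f' v"
    using assms(2) \<open>p \<in> S\<close> unfolding holo_on_iff by blast
  obtain g' where g: "(g has_derivative g') (at p)" "\<And>c v. g' (c *\<^sub>C v) = c *\<^sub>C g' v"
    using assms(3) \<open>p \<in> S\<close> unfolding holo_on_iff by blast
  show "\<exists>d. ((\<lambda>p. (f p, g p)) has_derivative d) (at p) \<and> (\<forall>c v. d (c *\<^sub>C v) = c *\<^sub>C d v)"
  proof (intro exI conjI allI)
    show "((\<lambda>p. (f p, g p)) has_derivative (\<lambda>v. (f' v, g' v))) (at p)"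
      by (rule has_derivative_Pair[OF f(1) g(1)])
  qed (simp add: scaleC_prod_def f(2) g(2))
qed

lemma holo_on_const: "holo_on S (\<lambda>p. c)"
  by (simp add: holo_on_def smooth_on_const scaleC_zero_right)

text \<open>
  In coordinates a ball lies in a box, and a box is a finite sum of compact segments.  Compactness
  is what makes the support of a bump function closed in the manifold.
\<close>

lemma compact_cball_complex: "compact (cball (p::'a::complex_euclidean_space) r)"
proof -
  obtain B :: "'a set" and l and b :: "'a \<Rightarrow> 'a" where "coordinate_system B l b"
    using coordinate_system_exists by blast
  then have fin: "finite B" and bl: "\<And>i. i \<in> B \<Longrightarrow> bounded_linear (l i)"
    and ex: "\<And>x. (\<Sum>i\<in>B. l i x *\<^sub>R b i) = x"
    unfolding coordinate_system_def by blast+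
  obtain M where M: "\<And>i x. i \<in> B \<Longrightarrow> \<bar>l i x\<bar> \<le> norm x * M i"
    using bl[THEN bounded_linear.bounded] unfolding real_norm_def by metis
  define R where "R = norm p + r"
  have K: "compact {\<Sum>i\<in>F. t i *\<^sub>R b i |t. \<forall>i\<in>F. \<bar>t i\<bar> \<le> R * \<bar>M i\<bar>}" if "finite F" for F
    using that
  proof induction
    case (insert j F)
    let ?A = "{\<Sum>i\<in>F. t i *\<^sub>R b i |t. \<forall>i\<in>F. \<bar>t i\<bar> \<le> R * \<bar>M i\<bar>}"
    let ?I = "(\<lambda>s. s *\<^sub>R b j) ` {- (R * \<bar>M j\<bar>)..R * \<bar>M j\<bar>}"
    have "{\<Sum>i\<in>insert j F. t i *\<^sub>R b i |t. \<forall>i\<in>insert j F. \<bar>t i\<bar> \<le> R * \<bar>M i\<bar>}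
        = {x + y |x y. x \<in> ?I \<and> y \<in> ?A}" (is "?L = ?R")
    proof
      show "?L \<subseteq> ?R"
        using insert.hyps by (fastforce simp: abs_le_iff)
      show "?R \<subseteq> ?L"
      proof
        fix z assume "z \<in> ?R"
        then obtain s t where s: "s \<in> {- (R * \<bar>M j\<bar>)..R * \<bar>M j\<bar>}"
          and t: "\<forall>i\<in>F. \<bar>t i\<bar> \<le> R * \<bar>M i\<bar>" and z: "z = s *\<^sub>R b j + (\<Sum>i\<in>F. t i *\<^sub>R b i)"
          by blast
        have "(\<Sum>i\<in>F. t i *\<^sub>R b i) = (\<Sum>i\<in>F. (t(j := s)) i *\<^sub>R b i)"
          using insert.hyps by (intro sum.cong) auto
        then show "z \<in> ?L"
          using insert.hyps s t z by (auto intro!: exI[of _ "t(j := s)"] simp: abs_le_iff)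
      qed
    qed
    moreover have "compact ?I"
      by (intro compact_continuous_image continuous_intros) auto
    ultimately show ?case using compact_sums[OF _ insert.IH] by simp
  qed auto
  have "cball p r \<subseteq> {\<Sum>i\<in>B. t i *\<^sub>R b i |t. \<forall>i\<in>B. \<bar>t i\<bar> \<le> R * \<bar>M i\<bar>}"
  proof
    fix x assume "x \<in> cball p r"
    then have "norm x \<le> R"
      unfolding R_def using norm_triangle_sub[of x p] by (simp add: dist_norm norm_minus_commute)
    then have bnd: "\<bar>l i x\<bar> \<le> R * \<bar>M i\<bar>" if "i \<in> B" for i
      using M[OF that, of x] by (smt (verit) mult_left_mono mult_right_mono norm_ge_zero)
    show "x \<in> {\<Sum>i\<in>B. t i *\<^sub>R b i |t. \<forall>i\<in>B. \<bar>t i\<bar> \<le> R * \<bar>M i\<bar>}"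
      by (intro CollectI exI[of _ "\<lambda>i. l i x"] conjI ballI ex[symmetric] bnd)
  qed
  then show ?thesis
    using compact_Int_closed[OF K[OF fin] closed_cball[of p r]] by (simp add: Int_absorb1)
qed

section \<open>Smooth bump functions\<close>

text \<open>
  The functions \<open>t\<^sup>-\<^sup>n exp (-1/t)\<close>, extended by \<open>0\<close> to \<open>t \<le> 0\<close>.  The whole family is considered at
  once because its linear span is closed under differentiation; smoothness of each member
  is then a single induction on the order of differentiability.
\<close>

definition flat :: "nat \<Rightarrow> real \<Rightarrow> real"
  where "flat n t = (if t \<le> 0 then 0 else inverse t ^ n * exp (- inverse t))"

lemma flat_has_derivative_zero: "(flat n has_real_derivative 0) (at 0)"
proof -
  \<comment> \<open>The difference quotient at \<open>0\<close> is the next member of the family.\<close>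
  have R: "((\<lambda>h. inverse h ^ Suc n * exp (- inverse h)) \<longlongrightarrow> 0) (at_right (0::real))"
  proof (rule filterlim_compose[OF _ filterlim_inverse_at_top_right])
    have "((\<lambda>x::real. x ^ Suc n / exp x) \<longlongrightarrow> 0) at_top"
      by (rule tendsto_power_div_exp_0)
    then show "((\<lambda>x::real. x ^ Suc n * exp (- x)) \<longlongrightarrow> 0) at_top"
      by (simp add: exp_minus divide_inverse)
  qed
  have "((\<lambda>h. flat n h / h) \<longlongrightarrow> 0) (at_right 0)"
    by (rule Lim_transform_eventually[OF R])
      (simp add: flat_def eventually_at_right_less field_simps
        eventually_mono[OF eventually_at_right_less[of 0]])
  moreover have "((\<lambda>h. flat n h / h) \<longlongrightarrow> 0) (at_left 0)"
    by (rule tendsto_eventually, rule eventually_mono[OF eventually_at_left_real[of "-1"]])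
      (simp_all add: flat_def)
  ultimately have "((\<lambda>h. flat n h / h) \<longlongrightarrow> 0) (at 0)"
    by (rule filterlim_split_at[rotated])
  then show ?thesis by (simp add: DERIV_def flat_def)
qed

lemma flat_has_derivative:
  "(flat n has_real_derivative flat (n + 2) t - real n * flat (n + 1) t) (at t)"
proof (cases "t = 0")
  case True
  then show ?thesis using flat_has_derivative_zero[of n] by (simp add: flat_def)
next
  case False
  show ?thesis
  proof (cases "t < 0")
    case True
    have "((\<lambda>_. 0) has_real_derivative 0) (at t)" by simp
    then have "(flat n has_real_derivative 0) (at t)"
      by (rule has_field_derivative_transform_within_open[of _ _ _ "{..<0}"])
        (use True in \<open>simp_all add: flat_def\<close>)
    then show ?thesis using True by (simp add: flat_def)
  next
    case F: False
    then have "t > 0" using False by simp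
    have "((\<lambda>t. inverse t ^ n * exp (- inverse t)) has_real_derivative
        flat (n + 2) t - real n * flat (n + 1) t) (at t)"
    proof -
      have "((\<lambda>t. inverse t ^ n * exp (- inverse t)) has_real_derivative
          real n * (- (inverse t)\<^sup>2) * inverse t ^ (n - 1) * exp (- inverse t)
            + exp (- inverse t) * (inverse t)\<^sup>2 * inverse t ^ n) (at t)"
        using \<open>t > 0\<close> by (auto intro!: derivative_eq_intros simp: power2_eq_square)
      then show ?thesis
        using \<open>t > 0\<close> by (cases n) (simp_all add: flat_def power2_eq_square algebra_simps)
    qed
    then show ?thesis
      by (rule has_field_derivative_transform_within_open[of _ _ _ "{0<..}"])
        (use \<open>t > 0\<close> in \<open>simp_all add: flat_def\<close>)
  qed
qed

lemma smooth_on_flat: "smooth_on UNIV (flat n)"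
proof -
  have "Ck_on k UNIV (flat n)" for k
  proof (induction k arbitrary: n)
    case 0
    show ?case unfolding Ck_on.simps
      by (rule continuous_at_imp_continuous_on) (blast intro: DERIV_isCont flat_has_derivative)
  next
    case (Suc k)
    show ?case
    proof (rule Ck_on_SucI[OF open_UNIV flat_has_derivative[unfolded has_field_derivative_def]])
      fix v
      have "Ck_on k UNIV (\<lambda>t. (- real n) * flat (n + 1) t)"
        by (rule Ck_on_linear[OF bounded_linear_mult_right open_UNIV Suc.IH])
      then have "Ck_on k UNIV (\<lambda>t. flat (n + 2) t + (- real n) * flat (n + 1) t)"
        by (rule Ck_on_add[OF open_UNIV Suc.IH])
      then have "Ck_on k UNIV (\<lambda>t. (flat (n + 2) t + (- real n) * flat (n + 1) t) * v)"
        by (rule Ck_on_linear[OF bounded_linear_mult_left open_UNIV])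
      then show "Ck_on k UNIV (\<lambda>t. (flat (n + 2) t - real n * flat (n + 1) t) * v)"
        by simp
    qed
  qed
  then show ?thesis by (simp add: smooth_on_def)
qed

lemma smooth_on_inverse: "smooth_on {0<..} (inverse :: real \<Rightarrow> real)"
proof -
  have "Ck_on k {0<..} (inverse :: real \<Rightarrow> real)" for k
  proof (induction k)
    case 0
    show ?case by (auto intro!: continuous_intros)
  next
    case (Suc k)
    show ?case
    proof (rule Ck_on_SucI[OF open_greaterThan])
      show "(inverse has_derivative (\<lambda>v. - (inverse p * v * inverse p))) (at p)"
        if "p \<in> {0<..}" for p :: real
        by (rule has_derivative_inverse') (use that in simp)
      show "Ck_on k {0<..} (\<lambda>p. - (inverse p * v * inverse p))" for v :: real
      proof (rule Ck_on_linear[OF bounded_linear_minus[OF bounded_linear_ident] open_greaterThan])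
        have "Ck_on k {0<..} (\<lambda>p. inverse p * v)"
          by (rule Ck_on_linear[OF bounded_linear_mult_left open_greaterThan Suc.IH])
        then show "Ck_on k {0<..} (\<lambda>p. inverse p * v * inverse p)"
          by (rule Ck_on_bilinear[OF bounded_bilinear_mult open_greaterThan _ Suc.IH])
      qed
    qed
  qed
  then show ?thesis by (simp add: smooth_on_def)
qed

text \<open>
  With \<open>f\<close> the flat function, take \<open>f (2 - t) / (f (2 - t) + f (t - 1))\<close>; the denominator never
  vanishes, as \<open>t < 2\<close> or \<open>t > 1\<close>.
\<close>

lemma smooth_step_exists:
  "\<exists>g::real \<Rightarrow> real. smooth_on UNIV g \<and> (\<forall>t\<le>1. g t = 1) \<and> (\<forall>t\<ge>2. g t = 0)"
proof -
  have aff: "smooth_on UNIV (\<lambda>t. flat 0 (a + c * t))" for a c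
  proof -
    have "smooth_on UNIV (\<lambda>t::real. a + c * t)"
      by (rule smooth_on_add[OF open_UNIV smooth_on_const
            smooth_on_linear[OF bounded_linear_mult_right open_UNIV smooth_on_id[OF open_UNIV]]])
    from smooth_on_compose_real[OF open_UNIV open_UNIV this smooth_on_flat[of 0]]
    show ?thesis by (simp add: o_def)
  qed
  let ?a = "\<lambda>t. flat 0 (2 + (- 1) * t)" and ?b = "\<lambda>t. flat 0 (- 1 + 1 * t)"
  have nonneg: "flat 0 t \<ge> 0" for t by (simp add: flat_def)
  have pos: "t > 0 \<Longrightarrow> flat 0 t > 0" for t by (simp add: flat_def)
  have sum_pos: "?a t + ?b t > 0" for t
    using nonneg pos by (cases "t < 2") (simp_all add: add_pos_nonneg add_nonneg_pos)
  have "smooth_on UNIV (\<lambda>t. ?a t + ?b t)"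
    by (rule smooth_on_add[OF open_UNIV aff aff])
  from smooth_on_compose_real[OF open_UNIV open_greaterThan this smooth_on_inverse]
  have "smooth_on UNIV (\<lambda>t. inverse (?a t + ?b t))"
    using sum_pos by (auto simp: o_def)
  then have "smooth_on UNIV (\<lambda>t. ?a t * inverse (?a t + ?b t))"
    by (rule smooth_on_bilinear[OF bounded_bilinear_mult open_UNIV aff])
  moreover have "?a t * inverse (?a t + ?b t) = 1" if "t \<le> 1" for t
    using that by (simp add: flat_def)
  moreover have "?a t * inverse (?a t + ?b t) = 0" if "t \<ge> 2" for t
    using that by (simp add: flat_def)
  ultimately show ?thesis by (intro exI[of _ "\<lambda>t. ?a t * inverse (?a t + ?b t)"]) blast
qed

lemma smooth_bump_exists:
  fixes p :: "'m::complex_euclidean_space"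
  assumes "r > 0"
  shows "\<exists>h::'m \<Rightarrow> real. \<exists>d>0. d \<le> r \<and> smooth_on UNIV h \<and>
    (\<forall>q. dist p q \<le> d \<longrightarrow> h q = 1) \<and> (\<forall>q. dist p q > r \<longrightarrow> h q = 0)"
proof -
  obtain g :: "real \<Rightarrow> real" where g: "smooth_on UNIV g" "\<And>t. t \<le> 1 \<Longrightarrow> g t = 1"
    "\<And>t. t \<ge> 2 \<Longrightarrow> g t = 0"
    using smooth_step_exists by blast
  let ?s = "\<lambda>q::'m. 2 / r\<^sup>2 * inner (q + - p) (q + - p)"
  have "smooth_on UNIV (\<lambda>q::'m. q + - p)"
    by (rule smooth_on_add[OF open_UNIV smooth_on_id[OF open_UNIV] smooth_on_const])
  from smooth_on_bilinear[OF bounded_bilinear_inner open_UNIV this this]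
  have "smooth_on UNIV ?s"
    by (rule smooth_on_linear[OF bounded_linear_mult_right open_UNIV])
  from smooth_on_compose_real[OF open_UNIV open_UNIV this g(1)]
  have "smooth_on UNIV (g \<circ> ?s)" by simp
  have s: "?s q = 2 * (dist p q / r)\<^sup>2" for q
    by (simp add: dist_norm norm_minus_commute power_divide flip: power2_norm_eq_inner)
  have "(g \<circ> ?s) q = 1" if "dist p q \<le> r / 2" for q
  proof -
    have "(dist p q / r)\<^sup>2 \<le> (1 / 2)\<^sup>2"
      using that assms by (intro power_mono) (simp_all add: field_simps)
    moreover have "(1 / 2 :: real)\<^sup>2 = 1 / 4" by (simp add: power2_eq_square)
    ultimately have "2 * (dist p q / r)\<^sup>2 \<le> 1" by linarith
    then show ?thesis unfolding o_def s by (rule g(2))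
  qed
  moreover have "(g \<circ> ?s) q = 0" if "dist p q > r" for q
  proof -
    have "1\<^sup>2 \<le> (dist p q / r)\<^sup>2"
      using that assms by (intro power_mono) (simp_all add: field_simps)
    then show ?thesis unfolding o_def s using g(3) by simp
  qed
  ultimately show ?thesis
    using \<open>smooth_on UNIV (g \<circ> ?s)\<close> assms by (intro exI[of _ "g \<circ> ?s"] exI[of _ "r / 2"]) simp
qed

section \<open>Maps between manifolds\<close>

lemma points_iff: "x \<in> points C \<longleftrightarrow> (\<exists>U \<phi>. (U, \<phi>) \<in> C \<and> x \<in> U)"
  unfolding points_def by (simp add: Bex_def)

lemma prod_atlasI: "(U, \<phi>) \<in> C \<Longrightarrow> (U \<times> UNIV, \<lambda>(x, z). (\<phi> x, z)) \<in> prod_atlas C"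
  unfolding prod_atlas_def by blast

lemma mfd_mapI:
  assumes "f ` W \<subseteq> points D"
    and "\<And>U \<phi> V \<psi>. (U, \<phi>) \<in> C \<Longrightarrow> (V, \<psi>) \<in> D \<Longrightarrow> open (\<phi> ` {x \<in> U \<inter> W. f x \<in> V}) \<and>
      P (\<phi> ` {x \<in> U \<inter> W. f x \<in> V}) (\<psi> \<circ> f \<circ> inv_into U \<phi>)"
  shows "mfd_map P C D W f"
  unfolding mfd_map_def Let_def using assms by blast

lemma mfd_mapD:
  assumes "mfd_map P C D W f"
  shows "f ` W \<subseteq> points D"
    and "(U, \<phi>) \<in> C \<Longrightarrow> (V, \<psi>) \<in> D \<Longrightarrow> open (\<phi> ` {x \<in> U \<inter> W. f x \<in> V})"
    and "(U, \<phi>) \<in> C \<Longrightarrow> (V, \<psi>) \<in> D \<Longrightarrow>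
      P (\<phi> ` {x \<in> U \<inter> W. f x \<in> V}) (\<psi> \<circ> f \<circ> inv_into U \<phi>)"
  using assms unfolding mfd_map_def Let_def by blast+

text \<open>
  Stated for three classes of maps, one for each factor and one for the composite, so that it yields
  both the smooth and the holomorphic case.  No chart of the middle manifold need cover the whole image,
  hence the composite is examined near each point, in a chart of the middle manifold around its image.
\<close>

lemma mfd_map_compose:
  assumes injC: "\<And>U \<phi>. (U, \<phi>) \<in> C \<Longrightarrow> inj_on \<phi> U"
    and injD: "\<And>U \<phi>. (U, \<phi>) \<in> D \<Longrightarrow> inj_on \<phi> U"
    and cont: "\<And>S f. P S f \<Longrightarrow> continuous_on S f"
    and sub: "\<And>S T f. P S f \<Longrightarrow> T \<subseteq> S \<Longrightarrow> P T f"
    and comp: "\<And>S T f g. open S \<Longrightarrow> open T \<Longrightarrow> P S f \<Longrightarrow> Q T g \<Longrightarrow> f ` S \<subseteq> T \<Longrightarrow> R S (g \<circ> f)"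
    and cong: "\<And>S f g. R S f \<Longrightarrow> open S \<Longrightarrow> (\<And>p. p \<in> S \<Longrightarrow> f p = g p) \<Longrightarrow> R S g"
    and local: "\<And>S f. (\<And>p. p \<in> S \<Longrightarrow> \<exists>T. open T \<and> p \<in> T \<and> R T f) \<Longrightarrow> R S f"
    and f: "mfd_map P C D W f" and g: "mfd_map Q D F W' g" and "f ` W \<subseteq> W'"
  shows "mfd_map R C F W (g \<circ> f)"
proof (rule mfd_mapI)
  show "(g \<circ> f) ` W \<subseteq> points F" using mfd_mapD(1)[OF g] \<open>f ` W \<subseteq> W'\<close> by auto
next
  fix U \<phi> V \<psi> assume c: "(U, \<phi>) \<in> C" and d: "(V, \<psi>) \<in> F"
  let ?S = "\<phi> ` {x \<in> U \<inter> W. (g \<circ> f) x \<in> V}" and ?h = "\<psi> \<circ> (g \<circ> f) \<circ> inv_into U \<phi>"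
  have loc: "\<exists>T. open T \<and> p \<in> T \<and> T \<subseteq> ?S \<and> R T ?h" if "p \<in> ?S" for p
  proof -
    obtain x where x: "p = \<phi> x" "x \<in> U" "x \<in> W" "g (f x) \<in> V" using \<open>p \<in> ?S\<close> by auto
    have "f x \<in> points D" using mfd_mapD(1)[OF f] x(3) by blast
    then obtain U2 \<beta> where e: "(U2, \<beta>) \<in> D" "f x \<in> U2"
      unfolding points_iff by blast
    let ?S1 = "\<phi> ` {x \<in> U \<inter> W. f x \<in> U2}" and ?f = "\<beta> \<circ> f \<circ> inv_into U \<phi>"
    let ?S2 = "\<beta> ` {y \<in> U2 \<inter> W'. g y \<in> V}" and ?g = "\<psi> \<circ> g \<circ> inv_into U2 \<beta>"
    note S1 = mfd_mapD(2,3)[OF f c e(1)] and S2 = mfd_mapD(2,3)[OF g e(1) d]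
    have iC: "inv_into U \<phi> (\<phi> y) = y" if "y \<in> U" for y
      using injC[OF c] that by simp
    have iD: "inv_into U2 \<beta> (\<beta> y) = y" if "y \<in> U2" for y
      using injD[OF e(1)] that by simp
    let ?T = "?S1 \<inter> ?f -` ?S2"
    have T: "open ?T"
      by (rule continuous_open_preimage[OF cont[OF S1(2)] S1(1) S2(1)])
    have pt: "\<exists>y. q = \<phi> y \<and> y \<in> U \<and> y \<in> W \<and> f y \<in> U2 \<and> g (f y) \<in> V" if q: "q \<in> ?T" for q
    proof -
      obtain y where y: "q = \<phi> y" "y \<in> U" "y \<in> W" "f y \<in> U2" using q by blast
      obtain z where z: "z \<in> U2" "g z \<in> V" "?f q = \<beta> z" using q by blast
      have "\<beta> (f y) = \<beta> z" using z(3) y iC by simp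
      then have "f y = z" using iD y(4) z(1) by metis
      then show ?thesis using y z by blast
    qed
    have "p \<in> ?T"
      using x e(2) iC \<open>f ` W \<subseteq> W'\<close> by auto
    moreover have "?T \<subseteq> ?S" using pt by fastforce
    moreover have "R ?T ?h"
    proof (rule cong[OF _ T])
      show "R ?T (?g \<circ> ?f)"
        by (rule comp[OF T S2(1) sub[OF S1(2)] S2(2)]) auto
      show "(?g \<circ> ?f) q = ?h q" if "q \<in> ?T" for q
        using pt[OF that] iC iD by auto
    qed
    ultimately show ?thesis using T by blast
  qed
  have "open ?S" using loc by (subst open_subopen) blast
  moreover have "R ?S ?h" by (rule local) (use loc in blast)
  ultimately show "open ?S \<and> R ?S ?h" ..
qed

lemma mfd_map_compose_smooth:
  fixes D :: "('b, 'n::complex_euclidean_space) chart set"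
    and C :: "('a, 'm::real_normed_vector) chart set"
    and F :: "('c, 'k::real_normed_vector) chart set"
  assumes "\<And>U \<phi>. (U, \<phi>) \<in> C \<Longrightarrow> inj_on \<phi> U" "\<And>U \<phi>. (U, \<phi>) \<in> D \<Longrightarrow> inj_on \<phi> U"
    and "mfd_map smooth_on C D W f" "mfd_map smooth_on D F W' g" "f ` W \<subseteq> W'"
  shows "mfd_map smooth_on C F W (g \<circ> f)"
  by (rule mfd_map_compose[where P = smooth_on and Q = smooth_on and R = smooth_on,
        OF assms(1,2) smooth_on_continuous
        smooth_on_subset smooth_on_compose smooth_on_cong smooth_on_local assms(3-5)])

lemma mfd_map_compose_holo:
  fixes D :: "('b, 'n::complex_euclidean_space) chart set"
    and C :: "('a, 'm::complex_euclidean_space) chart set"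
    and F :: "('c, 'k::complex_euclidean_space) chart set"
  assumes "\<And>U \<phi>. (U, \<phi>) \<in> C \<Longrightarrow> inj_on \<phi> U" "\<And>U \<phi>. (U, \<phi>) \<in> D \<Longrightarrow> inj_on \<phi> U"
    and "mfd_map holo_on C D W f" "mfd_map holo_on D F W' g" "f ` W \<subseteq> W'"
  shows "mfd_map holo_on C F W (g \<circ> f)"
  by (rule mfd_map_compose[where P = holo_on and Q = holo_on and R = holo_on, OF assms(1,2)
        smooth_on_continuous[OF holo_on_smooth_on]
        holo_on_subset holo_on_compose holo_on_cong holo_on_local assms(3-5)])

lemma mfd_map_holo_smooth: "mfd_map holo_on C D W f \<Longrightarrow> mfd_map smooth_on C D W f"
  by (rule mfd_mapI) (blast dest: mfd_mapD holo_on_smooth_on)+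

lemma mfd_map_cong:
  assumes inj: "\<And>U \<phi>. (U, \<phi>) \<in> C \<Longrightarrow> inj_on \<phi> U"
    and cong: "\<And>S f g. P S f \<Longrightarrow> open S \<Longrightarrow> (\<And>p. p \<in> S \<Longrightarrow> f p = g p) \<Longrightarrow> P S g"
    and f: "mfd_map P C D W f" and eq: "\<And>x. x \<in> W \<Longrightarrow> f x = g x"
  shows "mfd_map P C D W g"
proof (rule mfd_mapI)
  show "g ` W \<subseteq> points D" using mfd_mapD(1)[OF f] eq by auto
next
  fix U \<phi> V \<psi> assume c: "(U, \<phi>) \<in> C" and d: "(V, \<psi>) \<in> D"
  let ?S = "\<phi> ` {x \<in> U \<inter> W. f x \<in> V}"
  have S: "?S = \<phi> ` {x \<in> U \<inter> W. g x \<in> V}"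
    using eq by (intro arg_cong[of _ _ "image \<phi>"]) auto
  note f' = mfd_mapD(2,3)[OF f c d]
  have "P ?S (\<psi> \<circ> g \<circ> inv_into U \<phi>)"
    by (rule cong[OF f'(2,1)]) (use inj[OF c] eq in auto)
  then show "open (\<phi> ` {x \<in> U \<inter> W. g x \<in> V}) \<and>
      P (\<phi> ` {x \<in> U \<inter> W. g x \<in> V}) (\<psi> \<circ> g \<circ> inv_into U \<phi>)"
    using f'(1) unfolding S by simp
qed

lemma mfd_map_smooth_glue:
  assumes "f ` W \<subseteq> points D"
    and "\<And>x. x \<in> W \<Longrightarrow> \<exists>S. x \<in> S \<and> S \<subseteq> W \<and> mfd_map smooth_on C D S f"
  shows "mfd_map smooth_on C D W f"
proof (rule mfd_mapI)
  fix U \<phi> V \<psi> assume c: "(U, \<phi>) \<in> C" and d: "(V, \<psi>) \<in> D"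
  let ?S = "\<lambda>W. \<phi> ` {x \<in> U \<inter> W. f x \<in> V}" and ?f = "\<psi> \<circ> f \<circ> inv_into U \<phi>"
  have loc: "\<exists>T. open T \<and> p \<in> T \<and> T \<subseteq> ?S W \<and> smooth_on T ?f" if p: "p \<in> ?S W" for p
  proof -
    obtain x where x: "p = \<phi> x" "x \<in> U" "x \<in> W" "f x \<in> V" using p by auto
    obtain S where S: "x \<in> S" "S \<subseteq> W" "mfd_map smooth_on C D S f" using assms(2)[OF x(3)] by blast
    note mfd_mapD(2,3)[OF S(3) c d]
    moreover have "p \<in> ?S S" "?S S \<subseteq> ?S W" using S x by auto
    ultimately show ?thesis by blast
  qed
  have "open (?S W)" using loc by (subst open_subopen) blast
  moreover have "smooth_on (?S W) ?f" by (rule smooth_on_local) (use loc in blast)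
  ultimately show "open (?S W) \<and> smooth_on (?S W) ?f" ..
qed (rule assms(1))

lemma complex_manifoldD:
  assumes "complex_manifold C" "(U, \<phi>) \<in> C"
  shows "inj_on \<phi> U" "open (\<phi> ` U)"
    and "x \<in> U \<Longrightarrow> inv_into U \<phi> (\<phi> x) = x"
    and "(V, \<psi>) \<in> C \<Longrightarrow> open (\<phi> ` (U \<inter> V))"
    and "(V, \<psi>) \<in> C \<Longrightarrow> holo_on (\<phi> ` (U \<inter> V)) (\<psi> \<circ> inv_into U \<phi>)"
proof -
  have *: "\<forall>(U, \<phi>)\<in>C. inj_on \<phi> U \<and> open (\<phi> ` U)"
    "\<forall>(U, \<phi>)\<in>C. \<forall>(V, \<psi>)\<in>C. open (\<phi> ` (U \<inter> V)) \<and>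
       holo_on (\<phi> ` (U \<inter> V)) (\<psi> \<circ> inv_into U \<phi>)"
    using assms(1) unfolding complex_manifold_def by blast+
  show "inj_on \<phi> U" "open (\<phi> ` U)" using *(1) assms(2) by blast+
  then show "x \<in> U \<Longrightarrow> inv_into U \<phi> (\<phi> x) = x" by simp
  show "(V, \<psi>) \<in> C \<Longrightarrow> open (\<phi> ` (U \<inter> V))"
    "(V, \<psi>) \<in> C \<Longrightarrow> holo_on (\<phi> ` (U \<inter> V)) (\<psi> \<circ> inv_into U \<phi>)"
    using *(2) assms(2) by blast+
qed

lemma openin_mtop_image:
  "complex_manifold C \<Longrightarrow> openin (mtop C) W \<Longrightarrow> (U, \<phi>) \<in> C \<Longrightarrow> open (\<phi> ` (U \<inter> W))"
  by (auto simp: openin_mtop)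

lemma topspace_mtop:
  assumes "complex_manifold C"
  shows "topspace (mtop C) = points C"
proof -
  have "U \<inter> points C = U" if "(U, \<phi>) \<in> C" for U \<phi>
    using that unfolding points_def by auto
  then have "openin (mtop C) (points C)"
    using complex_manifoldD(2)[OF assms] by (auto simp: openin_mtop[OF assms])
  moreover have "topspace (mtop C) \<subseteq> points C"
    using openin_topspace[of "mtop C"] unfolding openin_mtop[OF assms] by blast
  ultimately show ?thesis using openin_subset by blast
qed

lemma mfd_map_smooth_subset:
  assumes C: "complex_manifold C" and f: "mfd_map smooth_on C D W f"
    and S: "openin (mtop C) S" "S \<subseteq> W"
  shows "mfd_map smooth_on C D S f"
proof (rule mfd_mapI)
  show "f ` S \<subseteq> points D" using mfd_mapD(1)[OF f] S(2) by blast
next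
  fix U \<phi> V \<psi> assume c: "(U, \<phi>) \<in> C" and d: "(V, \<psi>) \<in> D"
  note f' = mfd_mapD(2,3)[OF f c d]
  have "\<phi> ` {x \<in> U \<inter> S. f x \<in> V} = \<phi> ` (U \<inter> S) \<inter> \<phi> ` {x \<in> U \<inter> W. f x \<in> V}"
    using complex_manifoldD(1)[OF C c] S(2) by (auto simp: inj_on_def)
  then have "open (\<phi> ` {x \<in> U \<inter> S. f x \<in> V})"
    using f'(1) openin_mtop_image[OF C S(1) c] by auto
  moreover have "\<phi> ` {x \<in> U \<inter> S. f x \<in> V} \<subseteq> \<phi> ` {x \<in> U \<inter> W. f x \<in> V}"
    using S(2) by blast
  ultimately show "open (\<phi> ` {x \<in> U \<inter> S. f x \<in> V}) \<and>
      smooth_on (\<phi> ` {x \<in> U \<inter> S. f x \<in> V}) (\<psi> \<circ> f \<circ> inv_into U \<phi>)"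
    using smooth_on_subset[OF f'(2)] by blast
qed

lemma openin_chart_preimage:
  assumes C: "complex_manifold C" and c: "(U, \<phi>) \<in> C" and "open A"
  shows "openin (mtop C) {x \<in> U. \<phi> x \<in> A}"
  unfolding openin_mtop[OF C]
proof (intro conjI ballI)
  show "{x \<in> U. \<phi> x \<in> A} \<subseteq> points C" using c unfolding points_def by force
  fix d assume d: "d \<in> C"
  obtain V \<psi> where [simp]: "d = (V, \<psi>)" by (metis surj_pair)
  note D = complex_manifoldD[OF C d[simplified]]
  have "\<psi> ` (V \<inter> {x \<in> U. \<phi> x \<in> A}) = \<psi> ` (V \<inter> U) \<inter> (\<phi> \<circ> inv_into V \<psi>) -` A"
    using D(3) by auto
  moreover have "open \<dots>"
    by (rule continuous_open_preimage[OF _ D(4)[OF c] \<open>open A\<close>])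
      (rule smooth_on_continuous[OF holo_on_smooth_on[OF D(5)[OF c]]])
  ultimately show "case d of (V, \<psi>) \<Rightarrow> open (\<psi> ` (V \<inter> {x \<in> U. \<phi> x \<in> A}))" by simp
qed

lemma openin_chart_domain: "complex_manifold C \<Longrightarrow> (U, \<phi>) \<in> C \<Longrightarrow> openin (mtop C) U"
  using openin_chart_preimage[of C U \<phi> UNIV] by simp

lemma mfd_fun_iff:
  "mfd_fun P C W f \<longleftrightarrow>
    (\<forall>(U, \<phi>)\<in>C. open (\<phi> ` (U \<inter> W)) \<and> P (\<phi> ` (U \<inter> W)) (f \<circ> inv_into U \<phi>))"
proof -
  have "{x \<in> U \<inter> W. f x \<in> UNIV} = U \<inter> W" for U by auto
  then show ?thesis by (simp add: mfd_map_def Let_def points_def comp_def)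
qed

lemma mfd_funD:
  assumes "mfd_fun P C W f" "(U, \<phi>) \<in> C"
  shows "open (\<phi> ` (U \<inter> W))" "P (\<phi> ` (U \<inter> W)) (f \<circ> inv_into U \<phi>)"
  using assms unfolding mfd_fun_iff by blast+

lemma mfd_funI:
  assumes "\<And>U \<phi>. (U, \<phi>) \<in> C \<Longrightarrow> open (\<phi> ` (U \<inter> W)) \<and> P (\<phi> ` (U \<inter> W)) (f \<circ> inv_into U \<phi>)"
  shows "mfd_fun P C W f"
  using assms unfolding mfd_fun_iff by blast

lemma mfd_fun_smooth_linear:
  assumes "bounded_linear L" "mfd_fun smooth_on C W f"
  shows "mfd_fun smooth_on C W (\<lambda>x. L (f x))"
proof (rule mfd_funI)
  fix U \<phi> assume c: "(U, \<phi>) \<in> C"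
  have "smooth_on (\<phi> ` (U \<inter> W)) (\<lambda>p. L (f (inv_into U \<phi> p)))"
    by (rule smooth_on_linear[OF assms(1) mfd_funD[OF assms(2) c, unfolded o_def]])
  then show "open (\<phi> ` (U \<inter> W)) \<and> smooth_on (\<phi> ` (U \<inter> W)) ((\<lambda>x. L (f x)) \<circ> inv_into U \<phi>)"
    using mfd_funD(1)[OF assms(2) c] by (simp add: o_def)
qed

lemma mfd_fun_smooth_add:
  assumes "mfd_fun smooth_on C W f" "mfd_fun smooth_on C W g"
  shows "mfd_fun smooth_on C W (\<lambda>x. f x + g x)"
proof (rule mfd_funI)
  fix U \<phi> assume c: "(U, \<phi>) \<in> C"
  have "smooth_on (\<phi> ` (U \<inter> W)) (\<lambda>p. f (inv_into U \<phi> p) + g (inv_into U \<phi> p))"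
    by (rule smooth_on_add[OF mfd_funD[OF assms(1) c, unfolded o_def]
        mfd_funD(2)[OF assms(2) c, unfolded o_def]])
  then show "open (\<phi> ` (U \<inter> W)) \<and> smooth_on (\<phi> ` (U \<inter> W)) ((\<lambda>x. f x + g x) \<circ> inv_into U \<phi>)"
    using mfd_funD(1)[OF assms(1) c] by (simp add: o_def)
qed

lemma mfd_fun_smooth_bilinear:
  assumes "bounded_bilinear B" "mfd_fun smooth_on C W f" "mfd_fun smooth_on C W g"
  shows "mfd_fun smooth_on C W (\<lambda>x. B (f x) (g x))"
proof (rule mfd_funI)
  fix U \<phi> assume c: "(U, \<phi>) \<in> C"
  have "smooth_on (\<phi> ` (U \<inter> W)) (\<lambda>p. B (f (inv_into U \<phi> p)) (g (inv_into U \<phi> p)))"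
    by (rule smooth_on_bilinear[OF assms(1) mfd_funD[OF assms(2) c, unfolded o_def]
        mfd_funD(2)[OF assms(3) c, unfolded o_def]])
  then show "open (\<phi> ` (U \<inter> W)) \<and> smooth_on (\<phi> ` (U \<inter> W)) ((\<lambda>x. B (f x) (g x)) \<circ> inv_into U \<phi>)"
    using mfd_funD(1)[OF assms(2) c] by (simp add: o_def)
qed

lemma mfd_fun_smooth_const:
  "complex_manifold C \<Longrightarrow> openin (mtop C) W \<Longrightarrow> mfd_fun smooth_on C W (\<lambda>x. c)"
  by (rule mfd_funI) (simp add: o_def smooth_on_const openin_mtop_image)

lemma mfd_fun_smooth_subset:
  assumes "complex_manifold C" "mfd_fun smooth_on C W f" "openin (mtop C) S" "S \<subseteq> W"
  shows "mfd_fun smooth_on C S f"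
proof (rule mfd_funI)
  fix U \<phi> assume c: "(U, \<phi>) \<in> C"
  have "smooth_on (\<phi> ` (U \<inter> W)) (f \<circ> inv_into U \<phi>)"
    by (rule mfd_funD[OF assms(2) c])
  moreover have "\<phi> ` (U \<inter> S) \<subseteq> \<phi> ` (U \<inter> W)" using assms(4) by blast
  ultimately show "open (\<phi> ` (U \<inter> S)) \<and> smooth_on (\<phi> ` (U \<inter> S)) (f \<circ> inv_into U \<phi>)"
    using smooth_on_subset openin_mtop_image[OF assms(1,3) c] by blast
qed

lemma mfd_fun_smooth_cong:
  assumes "complex_manifold C" "mfd_fun smooth_on C W f" "\<And>x. x \<in> W \<Longrightarrow> f x = g x"
  shows "mfd_fun smooth_on C W g"
  by (rule mfd_map_cong[OF complex_manifoldD(1)[OF assms(1)] smooth_on_cong assms(2,3)])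

lemma mfd_fun_smooth_glue:
  assumes "\<And>x. x \<in> W \<Longrightarrow> \<exists>S. x \<in> S \<and> S \<subseteq> W \<and> mfd_fun smooth_on C S f"
  shows "mfd_fun smooth_on C W f"
  by (rule mfd_map_smooth_glue[OF _ assms]) (simp add: points_def)

text \<open>
  The coordinate changes of the base enter through the first component; they are holomorphic,
  whatever the class of \<open>u\<close>.
\<close>

lemma mfd_map_graph:
  fixes C :: "('a, 'm::complex_euclidean_space) chart set" and u :: "'a \<Rightarrow> 'f"
  assumes C: "complex_manifold C" and W: "openin (mtop C) W"
    and sub: "\<And>S T f. P S f \<Longrightarrow> T \<subseteq> S \<Longrightarrow> P T f"
    and pair: "\<And>S f g. open S \<Longrightarrow> holo_on S f \<Longrightarrow> P S g \<Longrightarrow> Q S (\<lambda>p. (f p, g p))"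
    and u: "mfd_fun P C W u"
  shows "mfd_map Q C (prod_atlas C) W (\<lambda>x. (x, u x))"
proof (rule mfd_mapI)
  show "(\<lambda>x. (x, u x)) ` W \<subseteq> points (prod_atlas C)"
  proof (rule image_subsetI)
    fix x assume "x \<in> W"
    then obtain U \<phi> where "(U, \<phi>) \<in> C" "x \<in> U"
      using W unfolding openin_mtop[OF C] by (meson points_iff subsetD)
    then show "(x, u x) \<in> points (prod_atlas C)"
      using prod_atlasI[of U \<phi> C] unfolding points_iff by blast
  qed
next
  fix U \<phi> and V' :: "('a \<times> 'f) set" and \<psi>' :: "'a \<times> 'f \<Rightarrow> 'm \<times> 'f"
  assume c: "(U, \<phi>) \<in> C" and "(V', \<psi>') \<in> prod_atlas C"
  then obtain V \<psi> where V': "V' = V \<times> UNIV" "\<psi>' = (\<lambda>(x, z). (\<psi> x, z))" and d: "(V, \<psi>) \<in> C"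
    unfolding prod_atlas_def by auto
  have S: "\<phi> ` {x \<in> U \<inter> W. (x, u x) \<in> V \<times> UNIV} = \<phi> ` (U \<inter> (V \<inter> W))" by auto
  let ?S = "\<phi> ` (U \<inter> (V \<inter> W))"
  have "open ?S"
    by (rule openin_mtop_image[OF C openin_Int[OF openin_chart_domain[OF C d] W] c])
  moreover have "holo_on ?S (\<psi> \<circ> inv_into U \<phi>)"
    by (rule holo_on_subset[OF complex_manifoldD(5)[OF C c d]]) auto
  moreover have "P ?S (u \<circ> inv_into U \<phi>)"
  proof (rule sub)
    show "P (\<phi> ` (U \<inter> W)) (u \<circ> inv_into U \<phi>)" by (rule mfd_funD[OF u c])
  qed auto
  ultimately have "Q ?S (\<lambda>p. ((\<psi> \<circ> inv_into U \<phi>) p, (u \<circ> inv_into U \<phi>) p))"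
    by (rule pair)
  then show "open (\<phi> ` {x \<in> U \<inter> W. (x, u x) \<in> V'}) \<and>
      Q (\<phi> ` {x \<in> U \<inter> W. (x, u x) \<in> V'}) (\<psi>' \<circ> (\<lambda>x. (x, u x)) \<circ> inv_into U \<phi>)"
    using \<open>open ?S\<close> unfolding V' S by (simp add: o_def)
qed

lemma mfd_fun_snd:
  assumes F: "mfd_map smooth_on C (prod_atlas C) W F" and fst: "\<And>x. x \<in> W \<Longrightarrow> fst (F x) = x"
  shows "mfd_fun smooth_on C W (\<lambda>x. snd (F x))"
proof (rule mfd_funI)
  fix U \<phi> assume c: "(U, \<phi>) \<in> C"
  let ?\<psi> = "\<lambda>(x, z). (\<phi> x, z)"
  have d: "(U \<times> UNIV, ?\<psi>) \<in> prod_atlas C" using c by (rule prod_atlasI)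
  have "{x \<in> U \<inter> W. F x \<in> U \<times> UNIV} = U \<inter> W"
    using fst by (auto simp: mem_Times_iff)
  then have *: "open (\<phi> ` (U \<inter> W))" "smooth_on (\<phi> ` (U \<inter> W)) (?\<psi> \<circ> F \<circ> inv_into U \<phi>)"
    using mfd_mapD(2,3)[OF F c d] by simp_all
  have "smooth_on (\<phi> ` (U \<inter> W)) (\<lambda>p. snd ((?\<psi> \<circ> F \<circ> inv_into U \<phi>) p))"
    by (rule smooth_on_linear[OF bounded_linear_snd *])
  then show "open (\<phi> ` (U \<inter> W)) \<and> smooth_on (\<phi> ` (U \<inter> W)) ((\<lambda>x. snd (F x)) \<circ> inv_into U \<phi>)"
    using *(1) by (simp add: o_def case_prod_unfold)
qed

text \<open>
  A bump function of the model space is transported by a chart and extended by \<open>0\<close>.  The extension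
  is smooth because the transported ball is compact, and therefore closed in the Hausdorff space
  \<open>mtop C\<close>: the chart domain and the complement of that ball are two open sets that cover the manifold.
\<close>

lemma manifold_bump_exists:
  assumes C: "complex_manifold C" and W: "openin (mtop C) W" "x \<in> W"
  obtains \<beta> :: "'a \<Rightarrow> real" and K S
  where "mfd_fun smooth_on (C :: ('a, 'm::complex_euclidean_space) chart set) (points C) \<beta>"
    "closedin (mtop C) K" "K \<subseteq> W" "\<And>y. y \<in> points C - K \<Longrightarrow> \<beta> y = 0"
    "openin (mtop C) S" "x \<in> S" "S \<subseteq> W" "\<And>y. y \<in> S \<Longrightarrow> \<beta> y = 1"
proof -
  obtain U \<phi> where c: "(U, \<phi>) \<in> C" and "x \<in> U"
    using W unfolding openin_mtop[OF C] by (meson points_iff subsetD)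
  note D = complex_manifoldD[OF C c]
  have "open (\<phi> ` (U \<inter> W))" "\<phi> x \<in> \<phi> ` (U \<inter> W)"
    using openin_mtop_image[OF C W(1) c] W(2) \<open>x \<in> U\<close> by auto
  then obtain r where r: "r > 0" "cball (\<phi> x) r \<subseteq> \<phi> ` (U \<inter> W)"
    using open_contains_cball by blast
  obtain h :: "'m \<Rightarrow> real" and d where h: "d > 0" "d \<le> r" "smooth_on UNIV h"
    "\<And>q. dist (\<phi> x) q \<le> d \<Longrightarrow> h q = 1" "\<And>q. dist (\<phi> x) q > r \<Longrightarrow> h q = 0"
    using smooth_bump_exists[OF r(1), of "\<phi> x"] by blast
  define \<beta> where "\<beta> = (\<lambda>y. if y \<in> U then h (\<phi> y) else 0)"
  define K where "K = inv_into U \<phi> ` cball (\<phi> x) r"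
  define S where "S = {y \<in> U. \<phi> y \<in> ball (\<phi> x) d}"
  have "K \<subseteq> W" using r(2) D(3) unfolding K_def by fastforce
  have "closedin (mtop C) K"
  proof (rule compactin_imp_closedin)
    show "Hausdorff_space (mtop C)" using C unfolding complex_manifold_def by blast
    have "compactin (top_of_set (\<phi> ` U)) (cball (\<phi> x) r)"
      using r(2) compact_cball_complex by (auto simp: compactin_subtopology)
    moreover have "continuous_map (top_of_set (\<phi> ` U)) (mtop C) (inv_into U \<phi>)"
      unfolding continuous_map_def
    proof (intro conjI allI impI)
      show "inv_into U \<phi> \<in> topspace (top_of_set (\<phi> ` U)) \<rightarrow> topspace (mtop C)"
        using c D(3) unfolding topspace_mtop[OF C] points_def by force
      fix V assume "openin (mtop C) V"
      have "{p \<in> \<phi> ` U. inv_into U \<phi> p \<in> V} = \<phi> ` (U \<inter> V)" using D(3) by auto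
      then show "openin (top_of_set (\<phi> ` U))
          {p \<in> topspace (top_of_set (\<phi> ` U)). inv_into U \<phi> p \<in> V}"
        using openin_mtop_image[OF C \<open>openin (mtop C) V\<close> c] by (auto intro: open_subset)
    qed
    ultimately show "compactin (mtop C) K" unfolding K_def by (rule image_compactin)
  qed
  moreover have zero: "\<beta> y = 0" if "y \<notin> K" for y
  proof (cases "y \<in> U")
    case True
    then have "\<phi> y \<notin> cball (\<phi> x) r" using that D(3) unfolding K_def by (metis image_eqI)
    then show ?thesis using h(5) by (simp add: \<beta>_def)
  qed (simp add: \<beta>_def)
  moreover have "mfd_fun smooth_on C (points C) \<beta>"
  proof (rule mfd_fun_smooth_glue)
    fix y assume "y \<in> points C"
    show "\<exists>S. y \<in> S \<and> S \<subseteq> points C \<and> mfd_fun smooth_on C S \<beta>"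
    proof (cases "y \<in> U")
      case True
      have "mfd_fun smooth_on C U (h \<circ> \<phi>)"
      proof (rule mfd_funI)
        fix V \<psi> assume d: "(V, \<psi>) \<in> C"
        note D' = complex_manifoldD[OF C d]
        have "smooth_on (\<psi> ` (V \<inter> U)) (h \<circ> (\<phi> \<circ> inv_into V \<psi>))"
          by (rule smooth_on_compose[OF D'(4)[OF c] open_UNIV
                holo_on_smooth_on[OF D'(5)[OF c]] h(3)]) simp
        then show "open (\<psi> ` (V \<inter> U)) \<and> smooth_on (\<psi> ` (V \<inter> U)) (h \<circ> \<phi> \<circ> inv_into V \<psi>)"
          using D'(4)[OF c] by (simp add: comp_assoc)
      qed
      then have "mfd_fun smooth_on C U \<beta>"
        by (rule mfd_fun_smooth_cong[OF C]) (simp add: \<beta>_def)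
      moreover have "U \<subseteq> points C" using c unfolding points_def by force
      ultimately show ?thesis using True by blast
    next
      case False
      then have "y \<notin> K" using r(2) D(3) unfolding K_def by fastforce
      have "openin (mtop C) (points C - K)"
        using openin_diff[OF openin_topspace \<open>closedin (mtop C) K\<close>] by (simp add: topspace_mtop[OF C])
      then have "mfd_fun smooth_on C (points C - K) \<beta>"
        by (rule mfd_fun_smooth_cong[OF C mfd_fun_smooth_const[OF C, of _ 0]]) (simp add: zero)
      then show ?thesis using \<open>y \<in> points C\<close> \<open>y \<notin> K\<close> by blast
    qed
  qed
  moreover have "openin (mtop C) S"
    unfolding S_def by (rule openin_chart_preimage[OF C c open_ball])
  moreover have "x \<in> S" using \<open>x \<in> U\<close> h(1) by (simp add: S_def)
  moreover have "S \<subseteq> K"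
  proof
    fix y assume "y \<in> S"
    then have "y = inv_into U \<phi> (\<phi> y)" "\<phi> y \<in> cball (\<phi> x) r"
      using D(3) h(2) by (auto simp: S_def)
    then show "y \<in> K" unfolding K_def by (rule image_eqI)
  qed
  moreover have "\<beta> y = 1" if "y \<in> S" for y
    using that h(4) by (simp add: S_def \<beta>_def)
  ultimately show thesis using that \<open>K \<subseteq> W\<close> by (meson DiffD2 subset_trans)
qed

section \<open>Local triviality of holomorphic vector bundles\<close>

locale holo_bundle =
  fixes C :: "('a, 'm::complex_euclidean_space) chart set"
    and E :: "('a, 'e, 'm \<times> 'f::complex_euclidean_space) vbundle"
  assumes vector_bundle: "holomorphic_vector_bundle C E"
begin

abbreviation \<Gamma> :: "('a \<Rightarrow> 'e) set"
  where "\<Gamma> \<equiv> sections smooth_on C E (points C)"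

lemma base_manifold: "complex_manifold C" and total_manifold: "complex_manifold (total E)"
  using vector_bundle unfolding holomorphic_vector_bundle_def by blast+

lemma fiber_closed:
  assumes "x \<in> points C"
  shows "vzero E x \<in> fiber E x"
    and "e \<in> fiber E x \<Longrightarrow> e' \<in> fiber E x \<Longrightarrow> vadd E e e' \<in> fiber E x"
    and "e \<in> fiber E x \<Longrightarrow> vscale E c e \<in> fiber E x"
  using vector_bundle assms unfolding holomorphic_vector_bundle_def by blast+

definition local_triv :: "'a set \<Rightarrow> ('e \<Rightarrow> 'f) \<Rightarrow> bool"
  where "local_triv U \<tau> \<longleftrightarrow> openin (mtop C) U \<and> trivialization C E U \<tau>"

text \<open>
  The inverse of a trivialization, as a family of linear isomorphisms from the model fiber onto the
  fibers.
\<close>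

definition triv_inv :: "'a set \<Rightarrow> ('e \<Rightarrow> 'f) \<Rightarrow> 'a \<Rightarrow> 'f \<Rightarrow> 'e"
  where "triv_inv U \<tau> x z =
    inv_into {e \<in> points (total E). proj E e \<in> U} (\<lambda>e. (proj E e, \<tau> e)) (x, z)"

lemma local_triv_exists: "x \<in> points C \<Longrightarrow> \<exists>U \<tau>. local_triv U \<tau> \<and> x \<in> U"
  using vector_bundle unfolding holomorphic_vector_bundle_def local_triv_def by blast

lemma local_triv_subset: "local_triv U \<tau> \<Longrightarrow> U \<subseteq> points C"
  using openin_mtop[OF base_manifold] unfolding local_triv_def by blast

lemma local_triv_linear:
  assumes "local_triv U \<tau>" "x \<in> U"
  shows "\<tau> (vzero E x) = 0"
    and "e \<in> fiber E x \<Longrightarrow> e' \<in> fiber E x \<Longrightarrow> \<tau> (vadd E e e') = \<tau> e + \<tau> e'"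
    and "e \<in> fiber E x \<Longrightarrow> \<tau> (vscale E c e) = c *\<^sub>C \<tau> e"
  using assms unfolding local_triv_def trivialization_def by blast+

lemma local_triv_bij:
  assumes "local_triv U \<tau>"
  shows "bij_betw (\<lambda>e. (proj E e, \<tau> e)) {e \<in> points (total E). proj E e \<in> U} (U \<times> UNIV)"
  using assms unfolding local_triv_def trivialization_def Let_def by blast

lemma triv_inv:
  assumes "local_triv U \<tau>" "x \<in> U"
  shows "triv_inv U \<tau> x z \<in> fiber E x" "\<tau> (triv_inv U \<tau> x z) = z"
proof -
  let ?EU = "{e \<in> points (total E). proj E e \<in> U}" and ?\<Phi> = "\<lambda>e. (proj E e, \<tau> e)"
  have im: "(x, z) \<in> ?\<Phi> ` ?EU"
    using local_triv_bij[OF assms(1)] assms(2) unfolding bij_betw_def by simp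
  have "triv_inv U \<tau> x z \<in> ?EU"
    unfolding triv_inv_def by (rule inv_into_into[OF im])
  moreover have "?\<Phi> (triv_inv U \<tau> x z) = (x, z)"
    unfolding triv_inv_def by (rule f_inv_into_f[OF im])
  ultimately show "triv_inv U \<tau> x z \<in> fiber E x" "\<tau> (triv_inv U \<tau> x z) = z"
    unfolding fiber_def by simp_all
qed

lemma local_triv_inject:
  assumes "local_triv U \<tau>" "x \<in> U" "e \<in> fiber E x" "e' \<in> fiber E x" "\<tau> e = \<tau> e'"
  shows "e = e'"
  using local_triv_bij[OF assms(1)] assms(2-5) unfolding bij_betw_def
  by (auto simp: fiber_def dest!: inj_onD)

lemma prod_atlas_inj: "(V, \<psi>) \<in> prod_atlas C \<Longrightarrow> inj_on \<psi> V"
  using complex_manifoldD(1)[OF base_manifold] unfolding prod_atlas_def inj_on_def by fastforce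

lemma triv_inv_holomorphic:
  assumes "local_triv U \<tau>"
  shows "mfd_map holo_on (prod_atlas C) (total E) (U \<times> UNIV) (\<lambda>(x, z). triv_inv U \<tau> x z)"
  using assms unfolding local_triv_def trivialization_def Let_def triv_inv_def by simp

text \<open>
  Smoothness of a section, defined through charts of the total space, amounts to smoothness of its
  fiber coordinate in a trivialization: one direction composes the section with the trivialization,
  the converse below composes the graph of the coordinate with the inverse of the trivialization.
\<close>

lemma smooth_section_local_coord:
  assumes triv: "local_triv U \<tau>" and "W \<subseteq> U" and s: "mfd_map smooth_on C (total E) W s"
    and fib: "\<And>x. x \<in> W \<Longrightarrow> s x \<in> fiber E x"
  shows "mfd_fun smooth_on C W (\<lambda>x. \<tau> (s x))"
proof -
  let ?EU = "{e \<in> points (total E). proj E e \<in> U}" and ?\<Phi> = "\<lambda>e. (proj E e, \<tau> e)"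
  have \<Phi>: "mfd_map smooth_on (total E) (prod_atlas C) ?EU ?\<Phi>"
    using triv unfolding local_triv_def trivialization_def Let_def
    by (blast intro: mfd_map_holo_smooth)
  have "s ` W \<subseteq> ?EU" using fib \<open>W \<subseteq> U\<close> unfolding fiber_def by auto
  have "mfd_map smooth_on C (prod_atlas C) W (?\<Phi> \<circ> s)"
    by (rule mfd_map_compose_smooth[OF complex_manifoldD(1)[OF base_manifold]
          complex_manifoldD(1)[OF total_manifold] s \<Phi> \<open>s ` W \<subseteq> ?EU\<close>])
  from mfd_fun_snd[OF this] show ?thesis using fib unfolding fiber_def by simp
qed

lemma smooth_section_of_local_coord:
  assumes triv: "local_triv U \<tau>" and W: "openin (mtop C) W" "W \<subseteq> U"
    and s: "mfd_fun smooth_on C W (\<lambda>x. \<tau> (s x))"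
    and fib: "\<And>x. x \<in> W \<Longrightarrow> s x \<in> fiber E x"
  shows "mfd_map smooth_on C (total E) W s"
proof (rule mfd_map_cong[OF complex_manifoldD(1)[OF base_manifold] smooth_on_cong])
  have graph: "mfd_map smooth_on C (prod_atlas C) W (\<lambda>x. (x, \<tau> (s x)))"
    by (rule mfd_map_graph[where P = smooth_on and Q = smooth_on,
          OF base_manifold W(1) smooth_on_subset
          smooth_on_Pair[OF _ holo_on_smooth_on] s])
  show "mfd_map smooth_on C (total E) W
      ((\<lambda>(x, z). triv_inv U \<tau> x z) \<circ> (\<lambda>x. (x, \<tau> (s x))))"
    by (rule mfd_map_compose_smooth[OF complex_manifoldD(1)[OF base_manifold] prod_atlas_inj graph
          mfd_map_holo_smooth[OF triv_inv_holomorphic[OF triv]]])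
      (use W(2) in auto)
  show "((\<lambda>(x, z). triv_inv U \<tau> x z) \<circ> (\<lambda>x. (x, \<tau> (s x)))) x = s x" if "x \<in> W" for x
  proof -
    have "x \<in> U" using that W(2) by blast
    then show ?thesis
      using local_triv_inject[OF triv \<open>x \<in> U\<close> triv_inv(1)[OF triv \<open>x \<in> U\<close>] fib[OF that]]
        triv_inv(2)[OF triv \<open>x \<in> U\<close>] by simp
  qed
qed

lemma constant_section_holomorphic:
  assumes triv: "local_triv U \<tau>" and W: "openin (mtop C) W" "W \<subseteq> U"
  shows "mfd_map holo_on C (total E) W (\<lambda>x. triv_inv U \<tau> x z)"
proof -
  have const: "mfd_fun holo_on C W (\<lambda>x. z)"
    by (rule mfd_funI) (simp add: o_def holo_on_const openin_mtop_image[OF base_manifold W(1)])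
  have graph: "mfd_map holo_on C (prod_atlas C) W (\<lambda>x. (x, z))"
    by (rule mfd_map_graph[where P = holo_on and Q = holo_on,
          OF base_manifold W(1) holo_on_subset holo_on_Pair const])
  have "mfd_map holo_on C (total E) W ((\<lambda>(x, z). triv_inv U \<tau> x z) \<circ> (\<lambda>x. (x, z)))"
    by (rule mfd_map_compose_holo[OF complex_manifoldD(1)[OF base_manifold] prod_atlas_inj graph
          triv_inv_holomorphic[OF triv]])
      (use W(2) in auto)
  then show ?thesis by (simp add: o_def)
qed

lemma sectionD:
  assumes "s \<in> \<Gamma>"
  shows "s \<in> extensional (points C)" "x \<in> points C \<Longrightarrow> s x \<in> fiber E x"
  using assms unfolding sections_def by blast+

lemma section_coord_smooth:
  assumes s: "s \<in> \<Gamma>" and triv: "local_triv U \<tau>"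
  shows "mfd_fun smooth_on C U (\<lambda>x. \<tau> (s x))"
proof (rule smooth_section_local_coord[OF triv order_refl])
  have "mfd_map smooth_on C (total E) (points C) s" using s unfolding sections_def by blast
  then show "mfd_map smooth_on C (total E) U s"
    by (rule mfd_map_smooth_subset[OF base_manifold _ _ local_triv_subset[OF triv]])
      (use triv local_triv_def in blast)
  show "s x \<in> fiber E x" if "x \<in> U" for x
    using sectionD(2)[OF s] local_triv_subset[OF triv] that by blast
qed

lemma sectionI:
  assumes "s \<in> extensional (points C)" and fib: "\<And>x. x \<in> points C \<Longrightarrow> s x \<in> fiber E x"
    and loc: "\<And>x. x \<in> points C \<Longrightarrow> \<exists>U \<tau> S. local_triv U \<tau> \<and> openin (mtop C) S \<and> x \<in> S \<and> S \<subseteq> U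
      \<and> mfd_fun smooth_on C S (\<lambda>x. \<tau> (s x))"
  shows "s \<in> \<Gamma>"
proof -
  have "mfd_map smooth_on C (total E) (points C) s"
  proof (rule mfd_map_smooth_glue)
    show "s ` points C \<subseteq> points (total E)" using fib unfolding fiber_def by blast
    fix x assume "x \<in> points C"
    then obtain U \<tau> S where *: "local_triv U \<tau>" "openin (mtop C) S" "x \<in> S" "S \<subseteq> U"
      "mfd_fun smooth_on C S (\<lambda>x. \<tau> (s x))"
      using loc by blast
    then have "S \<subseteq> points C" using local_triv_subset by blast
    moreover have "mfd_map smooth_on C (total E) S s"
      by (rule smooth_section_of_local_coord[OF *(1,2,4,5)]) (use fib \<open>S \<subseteq> points C\<close> in blast)
    ultimately show "\<exists>S. x \<in> S \<and> S \<subseteq> points C \<and> mfd_map smooth_on C (total E) S s"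
      using *(3) by blast
  qed
  then show ?thesis using assms(1) fib unfolding sections_def by blast
qed

lemma section_of_coords:
  assumes "s \<in> extensional (points C)" and fib: "\<And>x. x \<in> points C \<Longrightarrow> s x \<in> fiber E x"
    and loc: "\<And>U \<tau>. local_triv U \<tau> \<Longrightarrow> mfd_fun smooth_on C U (\<lambda>x. \<tau> (s x))"
  shows "s \<in> \<Gamma>"
proof (rule sectionI[OF assms(1,2)])
  fix x assume "x \<in> points C"
  then obtain U \<tau> where *: "local_triv U \<tau>" "x \<in> U" using local_triv_exists by blast
  then show "\<exists>U \<tau> S. local_triv U \<tau> \<and> openin (mtop C) S \<and> x \<in> S \<and> S \<subseteq> U
      \<and> mfd_fun smooth_on C S (\<lambda>x. \<tau> (s x))"
    using loc[OF *(1)] unfolding local_triv_def by blast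
qed

text \<open>
  An identity between sections may be checked in fiber coordinates.  This is the way in which all
  fiberwise identities are reduced to computations in a vector space.
\<close>

lemma section_eqI:
  assumes "s \<in> extensional (points C)" "t \<in> extensional (points C)"
    and "\<And>x. x \<in> points C \<Longrightarrow> s x \<in> fiber E x" "\<And>x. x \<in> points C \<Longrightarrow> t x \<in> fiber E x"
    and "\<And>U \<tau> x. local_triv U \<tau> \<Longrightarrow> x \<in> U \<Longrightarrow> x \<in> points C \<Longrightarrow> \<tau> (s x) = \<tau> (t x)"
  shows "s = t"
proof (rule extensionalityI[OF assms(1,2)])
  fix x assume x: "x \<in> points C"
  then obtain U \<tau> where *: "local_triv U \<tau>" "x \<in> U" using local_triv_exists by blast
  show "s x = t x"
    by (rule local_triv_inject[OF * assms(3,4)[OF x] assms(5)[OF * x]])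
qed

lemma sec_add_coord:
  assumes "local_triv U \<tau>" "x \<in> U" "V x \<in> fiber E x" "W x \<in> fiber E x"
  shows "\<tau> (sec_add E (points C) V W x) = \<tau> (V x) + \<tau> (W x)"
  using assms local_triv_linear(2)[OF assms] local_triv_subset[OF assms(1)]
  unfolding sec_add_def by auto

lemma sec_mult_coord:
  assumes "local_triv U \<tau>" "x \<in> U" "V x \<in> fiber E x"
  shows "\<tau> (sec_mult E (points C) f V x) = f x *\<^sub>C \<tau> (V x)"
  using assms local_triv_linear(3)[OF assms] local_triv_subset[OF assms(1)]
  unfolding sec_mult_def by auto

lemma sec_add_fiber:
  "x \<in> points C \<Longrightarrow> V x \<in> fiber E x \<Longrightarrow> W x \<in> fiber E x
    \<Longrightarrow> sec_add E (points C) V W x \<in> fiber E x"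
  unfolding sec_add_def using fiber_closed(2) by simp

lemma sec_mult_fiber:
  "x \<in> points C \<Longrightarrow> V x \<in> fiber E x \<Longrightarrow> sec_mult E (points C) f V x \<in> fiber E x"
  unfolding sec_mult_def using fiber_closed(3) by simp

lemma sec_extensional:
  "sec_add E (points C) V W \<in> extensional (points C)"
  "sec_mult E (points C) f V \<in> extensional (points C)"
  unfolding sec_add_def sec_mult_def by simp_all

lemma section_add: assumes "V \<in> \<Gamma>" "W \<in> \<Gamma>" shows "sec_add E (points C) V W \<in> \<Gamma>"
proof (rule section_of_coords[OF sec_extensional(1)])
  show "sec_add E (points C) V W x \<in> fiber E x" if "x \<in> points C" for x
    using that sec_add_fiber sectionD(2) assms by blast
  fix U \<tau> assume t: "local_triv U \<tau>"
  have "mfd_fun smooth_on C U (\<lambda>x. \<tau> (V x) + \<tau> (W x))"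
    by (rule mfd_fun_smooth_add[OF assms[THEN section_coord_smooth, OF t]])
  then show "mfd_fun smooth_on C U (\<lambda>x. \<tau> (sec_add E (points C) V W x))"
    by (rule mfd_fun_smooth_cong[OF base_manifold])
      (metis sec_add_coord[OF t] assms[THEN sectionD(2)] local_triv_subset[OF t] subsetD)
qed

lemma section_scale: assumes "V \<in> \<Gamma>" shows "sec_mult E (points C) (\<lambda>_. c) V \<in> \<Gamma>"
proof (rule section_of_coords[OF sec_extensional(2)])
  show "sec_mult E (points C) (\<lambda>_. c) V x \<in> fiber E x" if "x \<in> points C" for x
    using that sec_mult_fiber sectionD(2) assms by blast
  fix U \<tau> assume t: "local_triv U \<tau>"
  have "mfd_fun smooth_on C U (\<lambda>x. c *\<^sub>C \<tau> (V x))"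
    by (rule mfd_fun_smooth_linear[OF bounded_linear_scaleC section_coord_smooth[OF assms t]])
  then show "mfd_fun smooth_on C U (\<lambda>x. \<tau> (sec_mult E (points C) (\<lambda>_. c) V x))"
    by (rule mfd_fun_smooth_cong[OF base_manifold])
      (metis sec_mult_coord[OF t] sectionD(2)[OF assms] local_triv_subset[OF t] subsetD)
qed

lemma section_mult_real:
  assumes "V \<in> \<Gamma>" and f: "mfd_fun smooth_on C (points C) (f :: 'a \<Rightarrow> real)"
  shows "sec_mult E (points C) (\<lambda>x. of_real (f x)) V \<in> \<Gamma>"
proof (rule section_of_coords[OF sec_extensional(2)])
  show "sec_mult E (points C) (\<lambda>x. of_real (f x)) V x \<in> fiber E x" if "x \<in> points C" for x
    using that sec_mult_fiber sectionD(2) assms by blast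
  fix U \<tau> assume t: "local_triv U \<tau>"
  have "mfd_fun smooth_on C U f"
    by (rule mfd_fun_smooth_subset[OF base_manifold f _ local_triv_subset[OF t]])
      (use t local_triv_def in blast)
  then have "mfd_fun smooth_on C U (\<lambda>x. f x *\<^sub>R \<tau> (V x))"
    by (rule mfd_fun_smooth_bilinear[OF bounded_bilinear_scaleR _ section_coord_smooth[OF assms(1) t]])
  then show "mfd_fun smooth_on C U (\<lambda>x. \<tau> (sec_mult E (points C) (\<lambda>x. of_real (f x)) V x))"
    by (rule mfd_fun_smooth_cong[OF base_manifold])
      (metis sec_mult_coord[OF t] sectionD(2)[OF assms(1)] local_triv_subset[OF t] subsetD
        scaleC_of_real)
qed

text \<open>
  The section with fiber coordinate \<open>u\<close> over \<open>U\<close>, cut off by \<open>\<beta>\<close> and extended by zero.  For constant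
  \<open>u\<close> these are global replacements of the vectors of a holomorphic frame over \<open>U\<close>.
\<close>

definition bump_section :: "'a set \<Rightarrow> ('e \<Rightarrow> 'f) \<Rightarrow> ('a \<Rightarrow> real) \<Rightarrow> ('a \<Rightarrow> 'f) \<Rightarrow> 'a \<Rightarrow> 'e"
  where "bump_section U \<tau> \<beta> u =
    (\<lambda>x\<in>points C. if x \<in> U then triv_inv U \<tau> x (\<beta> x *\<^sub>R u x) else vzero E x)"

lemma bump_section_coord:
  "local_triv U \<tau> \<Longrightarrow> x \<in> U \<Longrightarrow> \<tau> (bump_section U \<tau> \<beta> u x) = \<beta> x *\<^sub>R u x"
  unfolding bump_section_def using local_triv_subset triv_inv(2) by auto

lemma bump_section_fiber:
  "local_triv U \<tau> \<Longrightarrow> x \<in> points C \<Longrightarrow> bump_section U \<tau> \<beta> u x \<in> fiber E x"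
  unfolding bump_section_def using triv_inv(1) fiber_closed(1) by auto

lemma bump_section_extensional: "bump_section U \<tau> \<beta> u \<in> extensional (points C)"
  unfolding bump_section_def by simp

lemma bump_section_zero_coord:
  assumes "local_triv U \<tau>" "local_triv U' \<tau>'" "x \<in> U'" "x \<in> U \<Longrightarrow> \<beta> x *\<^sub>R u x = 0"
  shows "\<tau>' (bump_section U \<tau> \<beta> u x) = 0"
proof -
  have x: "x \<in> points C" using local_triv_subset[OF assms(2)] assms(3) by blast
  have "bump_section U \<tau> \<beta> u x = vzero E x"
  proof (cases "x \<in> U")
    case True
    show ?thesis
      by (rule local_triv_inject[OF assms(1) True bump_section_fiber[OF assms(1) x]
            fiber_closed(1)[OF x]])
        (simp add: bump_section_coord[OF assms(1) True] assms(4)[OF True]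
          local_triv_linear(1)[OF assms(1) True])
  qed (simp add: bump_section_def x)
  then show ?thesis using local_triv_linear(1)[OF assms(2,3)] by simp
qed

lemma openin_compl_closedin: "closedin (mtop C) K \<Longrightarrow> openin (mtop C) (points C - K)"
  using openin_diff[OF openin_topspace] by (metis topspace_mtop[OF base_manifold])

lemma bump_section_smooth:
  assumes triv: "local_triv U \<tau>" and \<beta>: "mfd_fun smooth_on C (points C) \<beta>"
    and K: "closedin (mtop C) K" "K \<subseteq> U" "\<And>x. x \<in> points C - K \<Longrightarrow> \<beta> x = 0"
    and u: "mfd_fun smooth_on C U u"
  shows "bump_section U \<tau> \<beta> u \<in> \<Gamma>"
proof (rule sectionI[OF bump_section_extensional bump_section_fiber[OF triv]])
  fix x assume x: "x \<in> points C"
  have openU: "openin (mtop C) U" using triv local_triv_def by blast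
  show "\<exists>U' \<tau>' S. local_triv U' \<tau>' \<and> openin (mtop C) S \<and> x \<in> S \<and> S \<subseteq> U'
      \<and> mfd_fun smooth_on C S (\<lambda>x. \<tau>' (bump_section U \<tau> \<beta> u x))"
  proof (cases "x \<in> U")
    case True
    have "mfd_fun smooth_on C U \<beta>"
      by (rule mfd_fun_smooth_subset[OF base_manifold \<beta> openU local_triv_subset[OF triv]])
    then have "mfd_fun smooth_on C U (\<lambda>x. \<beta> x *\<^sub>R u x)"
      by (rule mfd_fun_smooth_bilinear[OF bounded_bilinear_scaleR _ u])
    then have "mfd_fun smooth_on C U (\<lambda>x. \<tau> (bump_section U \<tau> \<beta> u x))"
      by (rule mfd_fun_smooth_cong[OF base_manifold]) (simp add: bump_section_coord[OF triv])
    then show ?thesis using triv openU True by blast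
  next
    case False
    obtain U' \<tau>' where t: "local_triv U' \<tau>'" "x \<in> U'" using local_triv_exists[OF x] by blast
    let ?S = "U' \<inter> (points C - K)"
    have S: "openin (mtop C) ?S"
      using t(1) openin_compl_closedin[OF K(1)] unfolding local_triv_def by blast
    have "mfd_fun smooth_on C ?S (\<lambda>x. \<tau>' (bump_section U \<tau> \<beta> u x))"
      by (rule mfd_fun_smooth_cong[OF base_manifold mfd_fun_smooth_const[OF base_manifold S, of 0]])
        (use bump_section_zero_coord[OF triv t(1)] K(3) in simp)
    moreover have "x \<in> ?S" using x t(2) False K(2) by blast
    ultimately show ?thesis using t(1) S by blast
  qed
qed

lemma bump_function_smooth:
  fixes f \<beta> :: "'a \<Rightarrow> real"
  assumes U: "openin (mtop C) U" and \<beta>: "mfd_fun smooth_on C (points C) \<beta>"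
    and K: "closedin (mtop C) K" "K \<subseteq> U" "\<And>x. x \<in> points C - K \<Longrightarrow> \<beta> x = 0"
    and f: "mfd_fun smooth_on C U f"
  shows "mfd_fun smooth_on C (points C) (\<lambda>x. if x \<in> U then \<beta> x * f x else 0)"
proof (rule mfd_fun_smooth_glue)
  fix x assume x: "x \<in> points C"
  let ?g = "\<lambda>x. if x \<in> U then \<beta> x * f x else 0"
  have "U \<subseteq> points C" using U openin_mtop[OF base_manifold] by blast
  show "\<exists>S. x \<in> S \<and> S \<subseteq> points C \<and> mfd_fun smooth_on C S ?g"
  proof (cases "x \<in> U")
    case True
    have "mfd_fun smooth_on C U \<beta>"
      by (rule mfd_fun_smooth_subset[OF base_manifold \<beta> U \<open>U \<subseteq> points C\<close>])
    then have "mfd_fun smooth_on C U (\<lambda>x. \<beta> x * f x)"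
      by (rule mfd_fun_smooth_bilinear[OF bounded_bilinear_mult _ f])
    then have "mfd_fun smooth_on C U ?g"
      by (rule mfd_fun_smooth_cong[OF base_manifold]) simp
    then show ?thesis using True \<open>U \<subseteq> points C\<close> by blast
  next
    case False
    have "mfd_fun smooth_on C (points C - K) ?g"
      by (rule mfd_fun_smooth_cong[OF base_manifold
            mfd_fun_smooth_const[OF base_manifold openin_compl_closedin[OF K(1)], of 0]])
        (use K(3) in simp)
    then show ?thesis using x False K(2) by blast
  qed
qed

text \<open>
  Where the cutoff equals \<open>1\<close>, the section is constant in a holomorphic trivialization.  This makes
  the bracket of two such sections accessible to the holomorphic structure.
\<close>

lemma bump_section_constant_holomorphic:
  assumes triv: "local_triv U \<tau>" and S: "openin (mtop C) S" "S \<subseteq> U" "\<And>x. x \<in> S \<Longrightarrow> \<beta> x = 1"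
  shows "restrict (bump_section U \<tau> \<beta> (\<lambda>_. z)) S \<in> sections holo_on C E S"
proof -
  have SX: "S \<subseteq> points C" using local_triv_subset[OF triv] S(2) by blast
  have "mfd_map holo_on C (total E) S (restrict (bump_section U \<tau> \<beta> (\<lambda>_. z)) S)"
  proof (rule mfd_map_cong[OF complex_manifoldD(1)[OF base_manifold] holo_on_cong
        constant_section_holomorphic[OF triv S(1,2)]])
    show "triv_inv U \<tau> x z = restrict (bump_section U \<tau> \<beta> (\<lambda>_. z)) S x" if "x \<in> S" for x
      using that S(2,3) SX unfolding bump_section_def by auto
  qed
  moreover have "\<forall>x\<in>S. restrict (bump_section U \<tau> \<beta> (\<lambda>_. z)) S x \<in> fiber E x"
    using bump_section_fiber[OF triv] SX by auto
  ultimately show ?thesis unfolding sections_def by simp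
qed

lemma scale_bump_section:
  assumes triv: "local_triv U \<tau>" and zero: "\<And>x. x \<in> points C - U \<Longrightarrow> \<beta> x = 0"
  shows "sec_mult E (points C) (\<lambda>_. c) (bump_section U \<tau> \<beta> (\<lambda>_. z))
    = bump_section U \<tau> \<beta> (\<lambda>_. c *\<^sub>C z)"
proof (rule section_eqI[OF sec_extensional(2) bump_section_extensional])
  fix x assume "x \<in> points C"
  then show "sec_mult E (points C) (\<lambda>_. c) (bump_section U \<tau> \<beta> (\<lambda>_. z)) x \<in> fiber E x"
    "bump_section U \<tau> \<beta> (\<lambda>_. c *\<^sub>C z) x \<in> fiber E x"
    by (simp_all add: bump_section_fiber[OF triv] sec_mult_fiber)
next
  fix U' \<tau>' x assume t: "local_triv U' \<tau>'" "x \<in> U'" and x: "x \<in> points C"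
  show "\<tau>' (sec_mult E (points C) (\<lambda>_. c) (bump_section U \<tau> \<beta> (\<lambda>_. z)) x)
    = \<tau>' (bump_section U \<tau> \<beta> (\<lambda>_. c *\<^sub>C z) x)"
  proof (cases "x \<in> U")
    case True
    have "sec_mult E (points C) (\<lambda>_. c) (bump_section U \<tau> \<beta> (\<lambda>_. z)) x
      = bump_section U \<tau> \<beta> (\<lambda>_. c *\<^sub>C z) x"
      by (rule local_triv_inject[OF triv True
            sec_mult_fiber[of x "bump_section U \<tau> \<beta> (\<lambda>_. z)",
              OF x bump_section_fiber[OF triv x]] bump_section_fiber[OF triv x]])
        (simp add: sec_mult_coord[where V = "bump_section U \<tau> \<beta> (\<lambda>_. z)",
              OF triv True bump_section_fiber[OF triv x]]
          bump_section_coord[OF triv True] scaleC_scaleR_commute)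
    then show ?thesis by simp
  next
    case False
    have "\<tau>' (bump_section U \<tau> \<beta> u x) = 0" for u
      by (rule bump_section_zero_coord[OF triv t]) (use False in simp)
    then show ?thesis
      by (simp add: sec_mult_coord[where V = "bump_section U \<tau> \<beta> (\<lambda>_. z)",
            OF t bump_section_fiber[OF triv x]] scaleC_zero_right)
  qed
qed

end

section \<open>The Nijenhuis torsion of the fiberwise complex structure\<close>

locale real_algebroid = holo_bundle C E
  for C :: "('a, 'm::complex_euclidean_space) chart set"
    and E :: "('a, 'e, 'm \<times> 'f::complex_euclidean_space) vbundle" +
  fixes \<rho> :: "'e \<Rightarrow> ('a, 'm) tvec"
    and br :: "('a \<Rightarrow> 'e) \<Rightarrow> ('a \<Rightarrow> 'e) \<Rightarrow> 'a \<Rightarrow> 'e"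
  assumes algebroid: "real_lie_algebroid C E \<rho> br"
begin

abbreviation J :: "('a \<Rightarrow> 'e) \<Rightarrow> 'a \<Rightarrow> 'e"
  where "J \<equiv> sec_mult E (points C) (\<lambda>_. \<i>)"

abbreviation N :: "('a \<Rightarrow> 'e) \<Rightarrow> ('a \<Rightarrow> 'e) \<Rightarrow> 'a \<Rightarrow> 'e"
  where "N \<equiv> nijenhuis_torsion C E br (vscale E \<i>)"

abbreviation times :: "('a \<Rightarrow> real) \<Rightarrow> ('a \<Rightarrow> 'e) \<Rightarrow> 'a \<Rightarrow> 'e"
  where "times f V \<equiv> sec_mult E (points C) (\<lambda>x. of_real (f x)) V"

lemma lie_bracket: "lie_bracket_on \<real> E (points C) \<Gamma> br"
  using algebroid unfolding real_lie_algebroid_def Let_def by (elim conjE)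

lemma br_closed: "V \<in> \<Gamma> \<Longrightarrow> W \<in> \<Gamma> \<Longrightarrow> br V W \<in> \<Gamma>"
  using lie_bracket unfolding lie_bracket_on_def by blast

lemma br_add:
  assumes "V \<in> \<Gamma>" "V' \<in> \<Gamma>" "W \<in> \<Gamma>"
  shows "br (sec_add E (points C) V V') W = sec_add E (points C) (br V W) (br V' W)"
    and "br W (sec_add E (points C) V V') = sec_add E (points C) (br W V) (br W V')"
  using lie_bracket assms unfolding lie_bracket_on_def by blast+

lemma br_self: "V \<in> \<Gamma> \<Longrightarrow> br V V = sec_zero E (points C)"
  using lie_bracket unfolding lie_bracket_on_def by blast

lemma br_leibniz:
  assumes "V \<in> \<Gamma>" "W \<in> \<Gamma>" "mfd_fun smooth_on C (points C) (f :: 'a \<Rightarrow> real)"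
  shows "br V (times f W) =
    sec_add E (points C) (times (\<lambda>x. tderiv C (\<rho> (V x)) f) W) (times f (br V W))"
  by (rule algebroid[unfolded real_lie_algebroid_def Let_def, THEN conjunct2, THEN conjunct2,
        THEN conjunct2, rule_format, OF assms])

text \<open>
  The endomorphism acts on sections as multiplication by the constant function \<open>\<i>\<close>; in this form all
  constituents of the torsion are instances of the three operations on sections.
\<close>

lemma torsion_eq:
  "N V W = sec_add E (points C) (br (J V) (J W)) (sec_mult E (points C) (\<lambda>_. - 1)
    (J (sec_add E (points C) (sec_add E (points C) (br (J V) W) (br V (J W)))
      (sec_mult E (points C) (\<lambda>_. - 1) (J (br V W))))))"
  by (simp add: nijenhuis_torsion_def sec_mult_def Let_def)

lemma torsion_section: "V \<in> \<Gamma> \<Longrightarrow> W \<in> \<Gamma> \<Longrightarrow> N V W \<in> \<Gamma>"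
  unfolding torsion_eq by (intro section_add section_scale br_closed)

lemma times_scale: "V \<in> \<Gamma> \<Longrightarrow> times f (sec_mult E (points C) (\<lambda>_. c) V)
    = sec_mult E (points C) (\<lambda>_. c) (times f V)"
  by (rule section_eqI[OF sec_extensional(2) sec_extensional(2)])
    (simp_all add: sec_mult_fiber sectionD(2) sec_mult_coord scaleC_scaleC mult.commute)

lemma scale_add: "V \<in> \<Gamma> \<Longrightarrow> W \<in> \<Gamma> \<Longrightarrow>
    sec_mult E (points C) (\<lambda>_. c) (sec_add E (points C) V W)
    = sec_add E (points C) (sec_mult E (points C) (\<lambda>_. c) V) (sec_mult E (points C) (\<lambda>_. c) W)"
  by (rule section_eqI[OF sec_extensional(2) sec_extensional(1)])
    (simp_all add: sec_mult_fiber sec_add_fiber sectionD(2) sec_mult_coord sec_add_coord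
      scaleC_add_right)

context
  fixes U \<tau> x
  assumes triv: "local_triv U \<tau>" and xU: "x \<in> U"
begin

lemma x_point: "x \<in> points C"
  using local_triv_subset[OF triv] xU by blast

lemma fib: "V \<in> \<Gamma> \<Longrightarrow> V x \<in> fiber E x"
  using sectionD(2) x_point by blast

lemma coord_add:
  "V \<in> \<Gamma> \<Longrightarrow> W \<in> \<Gamma> \<Longrightarrow> \<tau> (sec_add E (points C) V W x) = \<tau> (V x) + \<tau> (W x)"
  by (rule sec_add_coord[OF triv xU fib fib])

lemma coord_mult: "V \<in> \<Gamma> \<Longrightarrow> \<tau> (sec_mult E (points C) f V x) = f x *\<^sub>C \<tau> (V x)"
  by (rule sec_mult_coord[OF triv xU fib])

text \<open>
  Polarization of \<open>[Z, Z] = 0\<close>.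
\<close>

lemma br_swap_coord:
  assumes "V \<in> \<Gamma>" "W \<in> \<Gamma>"
  shows "\<tau> (br W V x) = - \<tau> (br V W x)"
proof -
  note S = section_add[OF assms] br_closed assms
  have zero: "\<tau> (br Z Z x) = 0" if "Z \<in> \<Gamma>" for Z
    by (simp add: br_self[OF that] sec_zero_def x_point local_triv_linear(1)[OF triv xU])
  have "0 = \<tau> (br (sec_add E (points C) V W) (sec_add E (points C) V W) x)"
    by (simp add: zero S)
  also have "\<dots> = \<tau> (br V W x) + \<tau> (br W V x)"
    by (simp add: br_add S coord_add section_add zero)
  finally show ?thesis by (simp add: eq_neg_iff_add_eq_0 add.commute)
qed

lemma br_times_coord:
  assumes "V \<in> \<Gamma>" "W \<in> \<Gamma>" "mfd_fun smooth_on C (points C) (f :: 'a \<Rightarrow> real)"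
  shows "\<tau> (br V (times f W) x) = tderiv C (\<rho> (V x)) f *\<^sub>R \<tau> (W x) + f x *\<^sub>R \<tau> (br V W x)"
proof -
  have "times g Z x \<in> fiber E x" if "Z \<in> \<Gamma>" for g Z
    by (rule sec_mult_fiber[where V = Z, OF x_point fib[OF that]])
  then show ?thesis
    by (simp add: br_leibniz[OF assms] sec_add_coord[OF triv xU] coord_mult br_closed assms
        scaleC_of_real)
qed

lemma torsion_coord:
  assumes "V \<in> \<Gamma>" "W \<in> \<Gamma>"
  shows "\<tau> (N V W x) = \<tau> (br (J V) (J W) x)
    - \<i> *\<^sub>C (\<tau> (br (J V) W x) + \<tau> (br V (J W) x) - \<i> *\<^sub>C \<tau> (br V W x))"
  unfolding torsion_eq
  by (simp add: coord_add coord_mult section_add section_scale br_closed assms scaleC_minus_one)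

lemma torsion_swap_coord:
  assumes "V \<in> \<Gamma>" "W \<in> \<Gamma>"
  shows "\<tau> (N W V x) = - \<tau> (N V W x)"
  using assms br_swap_coord[of V W] br_swap_coord[of "J V" W] br_swap_coord[of V "J W"]
    br_swap_coord[of "J V" "J W"]
  by (simp add: torsion_coord section_scale scaleC_minus_right scaleC_diff_right scaleC_add_right)

lemma torsion_add_coord:
  assumes "V \<in> \<Gamma>" "W \<in> \<Gamma>" "W' \<in> \<Gamma>"
  shows "\<tau> (N V (sec_add E (points C) W W') x) = \<tau> (N V W x) + \<tau> (N V W' x)"
  by (simp add: torsion_coord assms section_add section_scale scale_add br_add coord_add br_closed
      scaleC_add_right scaleC_diff_right)

text \<open>
  The derivative terms that the Leibniz rule produces are \<open>(\<rho>(jV) f) jW\<close> from \<open>[jV, f jW]\<close> and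
  \<open>(\<rho>(jV) f) W + (\<rho>(V) f) jW - j (\<rho>(V) f) W\<close> from the part to which \<open>-j\<close> is applied.  They cancel
  because \<open>j\<close> commutes with multiplication by real functions.
\<close>

lemma torsion_times_coord:
  assumes "V \<in> \<Gamma>" "W \<in> \<Gamma>" "mfd_fun smooth_on C (points C) (f :: 'a \<Rightarrow> real)"
  shows "\<tau> (N V (times f W) x) = f x *\<^sub>R \<tau> (N V W x)"
proof -
  have "J (times f W) = times f (J W)" by (simp add: times_scale assms)
  then show ?thesis
    by (simp add: torsion_coord assms section_mult_real section_scale br_times_coord coord_mult
        scaleC_add_right scaleC_diff_right scaleC_scaleR_commute scaleR_add_right scaleR_diff_right)
qed

end

text \<open>
  Let \<open>b\<^sub>i\<close> be a real basis of the model fiber, \<open>e\<^sub>i\<close> the cut-off section with constant coordinate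
  \<open>b\<^sub>i\<close>, and \<open>v\<^sub>i\<close> the coordinates of \<open>V\<close> over \<open>U\<close>.  Then \<open>\<beta>\<^sup>2 V\<close> is the sum of the sections
  \<open>(\<beta> v\<^sub>i) e\<^sub>i\<close>, and the functions \<open>\<beta> v\<^sub>i\<close>, unlike \<open>v\<^sub>i\<close>, are globally defined.  Tensoriality shows that
  the torsion vanishes on \<open>\<beta>\<^sup>2 V\<close>, and also that the factor \<open>\<beta>\<^sup>2\<close> may be removed at a point with
  \<open>\<beta> = 1\<close>.
\<close>

lemma torsion_zero_of_frame:
  assumes triv: "local_triv U \<tau>" and "x \<in> U"
    and \<beta>: "mfd_fun smooth_on C (points C) \<beta>"
      "closedin (mtop C) K" "K \<subseteq> U" "\<And>y. y \<in> points C - K \<Longrightarrow> \<beta> y = 0"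
    and "\<beta> x = 1" and T: "T \<in> \<Gamma>" and V: "V \<in> \<Gamma>"
    and frame: "\<And>z. \<tau> (N T (bump_section U \<tau> \<beta> (\<lambda>_. z)) x) = 0"
  shows "\<tau> (N T V x) = 0"
proof -
  have openU: "openin (mtop C) U" using triv local_triv_def by blast
  obtain B :: "'f set" and l and b :: "'f \<Rightarrow> 'f" where "coordinate_system B l b"
    using coordinate_system_exists by blast
  then have "finite B" and bl: "\<And>i. i \<in> B \<Longrightarrow> bounded_linear (l i)"
    and ex: "\<And>z. (\<Sum>i\<in>B. l i z *\<^sub>R b i) = z"
    unfolding coordinate_system_def by blast+
  let ?S = "bump_section U \<tau> \<beta>"
  define f where "f = (\<lambda>i y. if y \<in> U then \<beta> y * l i (\<tau> (V y)) else 0)"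
  have f: "mfd_fun smooth_on C (points C) (f i)" if "i \<in> B" for i
    unfolding f_def
    by (rule bump_function_smooth[OF openU \<beta>
          mfd_fun_smooth_linear[OF bl[OF that] section_coord_smooth[OF V triv]]])
  have const: "?S (\<lambda>_. z) \<in> \<Gamma>" for z
    by (rule bump_section_smooth[OF triv \<beta> mfd_fun_smooth_const[OF base_manifold openU]])
  have "?S (\<lambda>y. \<Sum>i\<in>F. f i y *\<^sub>R b i) \<in> \<Gamma> \<and> \<tau> (N T (?S (\<lambda>y. \<Sum>i\<in>F. f i y *\<^sub>R b i)) x) = 0"
    if "finite F" "F \<subseteq> B" for F
    using that
  proof (induction F)
    case empty
    then show ?case using const[of 0] frame[of 0] by simp
  next
    case (insert i F)
    let ?u = "\<lambda>y. \<Sum>i\<in>F. f i y *\<^sub>R b i"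
    have i: "i \<in> B" and u: "?S ?u \<in> \<Gamma>" "\<tau> (N T (?S ?u) x) = 0"
      using insert by blast+
    let ?W = "times (f i) (?S (\<lambda>_. b i))"
    have W: "?W \<in> \<Gamma>" by (rule section_mult_real[OF const f[OF i]])
    have "?S (\<lambda>y. \<Sum>i\<in>insert i F. f i y *\<^sub>R b i) = sec_add E (points C) ?W (?S ?u)"
    proof (rule section_eqI[OF bump_section_extensional sec_extensional(1)])
      show "?S (\<lambda>y. \<Sum>i\<in>insert i F. f i y *\<^sub>R b i) y \<in> fiber E y" if "y \<in> points C" for y
        by (rule bump_section_fiber[OF triv that])
      show "sec_add E (points C) ?W (?S ?u) y \<in> fiber E y" if "y \<in> points C" for y
        by (rule sectionD(2)[OF section_add[OF W u(1)] that])
      fix U' \<tau>' y assume t: "local_triv U' \<tau>'" "y \<in> U'" and y: "y \<in> points C"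
      show "\<tau>' (?S (\<lambda>y. \<Sum>i\<in>insert i F. f i y *\<^sub>R b i) y) = \<tau>' (sec_add E (points C) ?W (?S ?u) y)"
      proof (cases "y \<in> U")
        case True
        have "?S (\<lambda>y. \<Sum>i\<in>insert i F. f i y *\<^sub>R b i) y = sec_add E (points C) ?W (?S ?u) y"
        proof (rule local_triv_inject[OF triv True bump_section_fiber[OF triv y]
              sectionD(2)[OF section_add[OF W u(1)] y]])
          show "\<tau> (?S (\<lambda>y. \<Sum>i\<in>insert i F. f i y *\<^sub>R b i) y) = \<tau> (sec_add E (points C) ?W (?S ?u) y)"
            using insert.hyps
            by (simp add: bump_section_coord[OF triv True] coord_add[OF triv True W u(1)]
                coord_mult[OF triv True const] scaleC_of_real scaleR_add_right mult.commute)
        qed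
        then show ?thesis by simp
      next
        case False
        have "\<tau>' (?S v y) = 0" for v
          by (rule bump_section_zero_coord[OF triv t]) (use False in simp)
        then show ?thesis
          by (simp add: coord_add[OF t W u(1)] coord_mult[OF t const] scaleC_zero_right)
      qed
    qed
    moreover have "\<tau> (N T ?W x) = 0"
      by (simp add: torsion_times_coord[OF triv \<open>x \<in> U\<close> T const f[OF i]] frame)
    ultimately show ?case
      using section_add[OF W u(1)] torsion_add_coord[OF triv \<open>x \<in> U\<close> T W u(1)] u(2) by simp
  qed
  then have sum: "\<tau> (N T (?S (\<lambda>y. \<Sum>i\<in>B. f i y *\<^sub>R b i)) x) = 0"
    using \<open>finite B\<close> by blast
  have sq: "mfd_fun smooth_on C (points C) (\<lambda>y. \<beta> y * \<beta> y)"
    by (rule mfd_fun_smooth_bilinear[OF bounded_bilinear_mult \<beta>(1) \<beta>(1)])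
  have "?S (\<lambda>y. \<Sum>i\<in>B. f i y *\<^sub>R b i) = times (\<lambda>y. \<beta> y * \<beta> y) V"
  proof (rule section_eqI[OF bump_section_extensional sec_extensional(2)])
    note W = section_mult_real[OF V sq]
    show "?S (\<lambda>y. \<Sum>i\<in>B. f i y *\<^sub>R b i) y \<in> fiber E y" if "y \<in> points C" for y
      by (rule bump_section_fiber[OF triv that])
    show "times (\<lambda>y. \<beta> y * \<beta> y) V y \<in> fiber E y" if "y \<in> points C" for y
      by (rule sectionD(2)[OF W that])
    fix U' \<tau>' y assume t: "local_triv U' \<tau>'" "y \<in> U'" and y: "y \<in> points C"
    show "\<tau>' (?S (\<lambda>y. \<Sum>i\<in>B. f i y *\<^sub>R b i) y) = \<tau>' (times (\<lambda>y. \<beta> y * \<beta> y) V y)"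
    proof (cases "y \<in> U")
      case True
      have sum_y: "(\<Sum>i\<in>B. f i y *\<^sub>R b i) = \<beta> y *\<^sub>R \<tau> (V y)"
        using ex[of "\<tau> (V y)"] True by (simp add: f_def flip: scaleR_scaleR scaleR_sum_right)
      have "?S (\<lambda>y. \<Sum>i\<in>B. f i y *\<^sub>R b i) y = times (\<lambda>y. \<beta> y * \<beta> y) V y"
      proof (rule local_triv_inject[OF triv True bump_section_fiber[OF triv y] sectionD(2)[OF W y]])
        show "\<tau> (?S (\<lambda>y. \<Sum>i\<in>B. f i y *\<^sub>R b i) y) = \<tau> (times (\<lambda>y. \<beta> y * \<beta> y) V y)"
          unfolding bump_section_coord[OF triv True] coord_mult[OF triv True V] sum_y scaleC_of_real
          by simp
      qed
      then show ?thesis by simp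
    next
      case False
      then have "\<beta> y = 0" using \<beta>(3,4) y by blast
      moreover have "\<tau>' (?S v y) = 0" for v
        by (rule bump_section_zero_coord[OF triv t]) (use False in simp)
      ultimately show ?thesis
        using scaleC_of_real[of 0 "\<tau>' (V y)"] by (simp add: coord_mult[OF t V])
    qed
  qed
  then show ?thesis
    using sum torsion_times_coord[OF triv \<open>x \<in> U\<close> T V sq] \<open>\<beta> x = 1\<close> by simp
qed

text \<open>
  With a complex bilinear bracket and \<open>b = [V, W]\<close>, the torsion is \<open>i\<^sup>2 b - i (i b + i b - i b) = 0\<close>.
  The bracket \<open>brS\<close> is the one of holomorphic sections over \<open>S\<close>.
\<close>

lemma torsion_zero_of_complex_bilinear:
  assumes triv: "local_triv U \<tau>" and S: "x \<in> S" "S \<subseteq> U"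
    and brS: "lie_bracket_on UNIV E S (sections holo_on C E S) brS"
    and ext: "\<And>V W. V \<in> \<Gamma> \<Longrightarrow> W \<in> \<Gamma> \<Longrightarrow> restrict V S \<in> sections holo_on C E S
      \<Longrightarrow> restrict W S \<in> sections holo_on C E S
      \<Longrightarrow> restrict (br V W) S = brS (restrict V S) (restrict W S)"
    and VW: "V \<in> \<Gamma>" "W \<in> \<Gamma>"
    and holo: "restrict V S \<in> sections holo_on C E S" "restrict W S \<in> sections holo_on C E S"
      "restrict (J V) S \<in> sections holo_on C E S" "restrict (J W) S \<in> sections holo_on C E S"
  shows "\<tau> (N V W x) = 0"
proof -
  have xU: "x \<in> U" using S by blast
  have SX: "S \<subseteq> points C" using S(2) local_triv_subset[OF triv] by blast
  have JS: "restrict (J Z) S = sec_mult E S (\<lambda>_. \<i>) (restrict Z S)" for Z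
    using SX by (auto simp: sec_mult_def restrict_def fun_eq_iff)
  let ?V = "restrict V S" and ?W = "restrict W S"
  have val: "br Z Y x = brS (restrict Z S) (restrict Y S) x"
    if "Z \<in> \<Gamma>" "Y \<in> \<Gamma>" "restrict Z S \<in> sections holo_on C E S" "restrict Y S \<in> sections holo_on C E S"
    for Z Y
    using ext[OF that] S(1) by (metis restrict_apply')
  have closed: "brS ?V ?W \<in> sections holo_on C E S"
    using brS holo(1,2) unfolding lie_bracket_on_def by blast
  have right: "brS Z (sec_mult E S (\<lambda>_. \<i>) ?W) = sec_mult E S (\<lambda>_. \<i>) (brS Z ?W)"
    if "Z \<in> sections holo_on C E S" for Z
    using brS holo(2) that unfolding lie_bracket_on_def by blast
  have left: "brS (sec_mult E S (\<lambda>_. \<i>) ?V) ?W = sec_mult E S (\<lambda>_. \<i>) (brS ?V ?W)"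
    using brS holo(1,2) unfolding lie_bracket_on_def by blast
  let ?b = "brS ?V ?W x"
  have fib: "?b \<in> fiber E x" using closed S(1) unfolding sections_def by blast
  note fib' = fiber_closed(3)[OF subsetD[OF SX S(1)] fib]
  have JV: "J V \<in> \<Gamma>" and JW: "J W \<in> \<Gamma>" using VW section_scale by blast+
  have "br V W x = ?b" by (rule val[OF VW holo(1,2)])
  moreover have "br (J V) W x = vscale E \<i> ?b"
    unfolding val[OF JV VW(2) holo(3,2)] unfolding JS left using S(1) by (simp add: sec_mult_def)
  moreover have "br V (J W) x = vscale E \<i> ?b"
    unfolding val[OF VW(1) JW holo(1,4)] unfolding JS right[OF holo(1)]
    using S(1) by (simp add: sec_mult_def)
  moreover have "br (J V) (J W) x = vscale E \<i> (vscale E \<i> ?b)"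
    unfolding val[OF JV JW holo(3,4)] unfolding JS right[OF holo(3)[unfolded JS]] left
    using S(1) by (simp add: sec_mult_def)
  ultimately show ?thesis
    by (simp add: torsion_coord[OF triv xU VW] local_triv_linear(3)[OF triv xU] fib fib')
qed

end

theorem proposition3p4:
  fixes C :: "('a, 'm::complex_euclidean_space) chart set"
    and E :: "('a, 'e, 'm \<times> 'f::complex_euclidean_space) vbundle"
    and \<rho> :: "'e \<Rightarrow> ('a, 'm) tvec"
    and br :: "'a set \<Rightarrow> ('a \<Rightarrow> 'e) \<Rightarrow> ('a \<Rightarrow> 'e) \<Rightarrow> 'a \<Rightarrow> 'e"
    and brR :: "('a \<Rightarrow> 'e) \<Rightarrow> ('a \<Rightarrow> 'e) \<Rightarrow> 'a \<Rightarrow> 'e"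
  assumes "holomorphic_lie_algebroid C E \<rho> br"
    and "underlying_real_lie_algebroid C E \<rho> br brR"
  shows "\<forall>V\<in>sections smooth_on C E (points C). \<forall>W\<in>sections smooth_on C E (points C).
    nijenhuis_torsion C E brR (vscale E \<i>) V W = sec_zero E (points C)"
proof (intro ballI)
  interpret real_algebroid C E \<rho> brR
  proof
    show "holomorphic_vector_bundle C E"
      using assms(1) unfolding holomorphic_lie_algebroid_def by (elim conjE)
    show "real_lie_algebroid C E \<rho> brR"
      using assms(2) unfolding underlying_real_lie_algebroid_def by (elim conjE)
  qed
  have lie: "lie_bracket_on UNIV E S (sections holo_on C E S) (br S)" if "openin (mtop C) S" for S
    by (rule assms(1)[unfolded holomorphic_lie_algebroid_def, THEN conjunct2, THEN conjunct2,
          THEN conjunct1, rule_format, OF that])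
  have ext: "restrict (brR V W) S = br S (restrict V S) (restrict W S)"
    if "openin (mtop C) S" "V \<in> \<Gamma>" "W \<in> \<Gamma>" "restrict V S \<in> sections holo_on C E S"
      "restrict W S \<in> sections holo_on C E S" for S V W
    by (rule assms(2)[unfolded underlying_real_lie_algebroid_def, THEN conjunct2, rule_format,
          OF that])
  fix V W assume V: "V \<in> \<Gamma>" and W: "W \<in> \<Gamma>"
  have zero: "\<exists>U \<tau>. local_triv U \<tau> \<and> x \<in> U \<and> \<tau> (N V W x) = 0" if x: "x \<in> points C" for x
  proof -
    obtain U \<tau> where triv: "local_triv U \<tau>" and "x \<in> U"
      using local_triv_exists[OF x] by blast
    then have openU: "openin (mtop C) U" unfolding local_triv_def by blast
    obtain \<beta> :: "'a \<Rightarrow> real" and K S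
      where \<beta>: "mfd_fun smooth_on C (points C) \<beta>" "closedin (mtop C) K" "K \<subseteq> U"
          "\<And>y. y \<in> points C - K \<Longrightarrow> \<beta> y = 0"
        and S: "openin (mtop C) S" "x \<in> S" "S \<subseteq> U" "\<And>y. y \<in> S \<Longrightarrow> \<beta> y = 1"
      by (rule manifold_bump_exists[OF base_manifold openU \<open>x \<in> U\<close>]) (rule that; assumption)
    define e where "e z = bump_section U \<tau> \<beta> (\<lambda>_. z)" for z
    have e: "e z \<in> \<Gamma>" for z unfolding e_def
      by (rule bump_section_smooth[OF triv \<beta> mfd_fun_smooth_const[OF base_manifold openU]])
    have holo: "restrict (e z) S \<in> sections holo_on C E S" for z unfolding e_def
      by (rule bump_section_constant_holomorphic[OF triv S(1,3,4)])
    have Je: "J (e z) = e (\<i> *\<^sub>C z)" for z unfolding e_def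
      by (rule scale_bump_section[OF triv]) (use \<beta>(3,4) in blast)
    have ee: "\<tau> (N (e z) (e w) x) = 0" for z w
      by (rule torsion_zero_of_complex_bilinear[OF triv S(2,3) lie[OF S(1)] ext[OF S(1)] e e])
        (simp_all add: holo Je)
    \<comment> \<open>Tensoriality in the second argument is used twice; the swap in between replaces
      tensoriality in the first argument.\<close>
    have eV: "\<tau> (N (e z) V x) = 0" for z
      by (rule torsion_zero_of_frame[OF triv \<open>x \<in> U\<close> \<beta> S(4)[OF S(2)] e V])
        (assumption, fold e_def, rule ee)
    have Ve: "\<tau> (N V (e z) x) = 0" for z
      using torsion_swap_coord[OF triv \<open>x \<in> U\<close> e V] eV by simp
    have "\<tau> (N V W x) = 0"
      by (rule torsion_zero_of_frame[OF triv \<open>x \<in> U\<close> \<beta> S(4)[OF S(2)] V W])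
        (assumption, fold e_def, rule Ve)
    then show ?thesis using triv \<open>x \<in> U\<close> by blast
  qed
  show "N V W = sec_zero E (points C)"
  proof (rule extensionalityI[OF sectionD(1)[OF torsion_section[OF V W]]])
    show "sec_zero E (points C) \<in> extensional (points C)" by (simp add: sec_zero_def)
    fix x assume x: "x \<in> points C"
    then obtain U \<tau> where t: "local_triv U \<tau>" "x \<in> U" and "\<tau> (N V W x) = 0"
      using zero by blast
    then have "N V W x = vzero E x"
      using local_triv_inject[OF t sectionD(2)[OF torsion_section[OF V W] x] fiber_closed(1)[OF x]]
        local_triv_linear(1)[OF t] by simp
    then show "N V W x = sec_zero E (points C) x" using x by (simp add: sec_zero_def)
  qed
qed

end
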